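(* Let $(T_t)_{t\ge0}=(e^{-tA})_{t\ge 0}$ be a symmetric submarkovian semigroup on $L^2(X,d\mu)$ with generator $A$, where $(X,d\mu)$ is a $\sigma$-finite measure space, and let $\beta:(0,+\infty)\to\mathbb{R}$ be a function such that $$\int f^2\log\left(f/\|f\|_2\right)d\mu\le t\,Q(f)+\beta(t)\|f\|_2^2,\qquad t>0,$$ for all nonzero $0\le f\in\mathrm{Quad}(A)\cap L^1\cap L^\infty$. Define $$B(y)=\sup_{t>0}\left(\frac{ty}{2}-t\,\beta(1/t)\right),\quad y\in\mathbb{R},$$ assume that $\int^{\infty}\frac{dy}{B(y)}<\infty$, and let $M(t)$ be the inverse function of $q(s)=\int_s^{+\infty}\frac{dy}{B(y)}$, $s\in\mathbb{R}$. Then $$\|T_tf\|_\infty\le e^{M(t)}\|f\|_1$$ for any $t>0$ (and all $f\in L^1$).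
   Context: $A$ is nonnegative self-adjoint with $T_t=e^{-tA}$; submarkovian means the $T_t$ are positivity preserving and contractive on every $L^p$, $1\le p\le\infty$. $\mathrm{Quad}(A)$ is the domain of $\sqrt A$ in $L^2$ and $Q(f)=(\sqrt Af,\sqrt Af)$, which equals $(Af,f)$ for $f$ in the domain $\mathcal{D}(A)$. *)

theory Defs
  imports "HOL-Analysis.Analysis" "HOL-Probability.Essential_Supremum"
begin

section \<open>Real Lebesgue spaces\<close>

text \<open>
  Elements of \<open>L\<^sup>p(M)\<close> are represented by measurable functions, and two functions that
  agree almost everywhere represent the same element.
\<close>

definition Lp :: "'a measure \<Rightarrow> ereal \<Rightarrow> ('a \<Rightarrow> real) set" where
  "Lp M p = {f \<in> borel_measurable M.
     if p = \<infinity> then \<exists>C. AE x in M. \<bar>f x\<bar> \<le> C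
     else integrable M (\<lambda>x. \<bar>f x\<bar> powr real_of_ereal p)}"

definition Lp_norm :: "'a measure \<Rightarrow> ereal \<Rightarrow> ('a \<Rightarrow> real) \<Rightarrow> real" where
  "Lp_norm M p f =
     (if p = \<infinity> then real_of_ereal (esssup M (\<lambda>x. ereal \<bar>f x\<bar>))
      else (\<integral>x. \<bar>f x\<bar> powr real_of_ereal p \<partial>M) powr (1 / real_of_ereal p))"

definition L2_inner :: "'a measure \<Rightarrow> ('a \<Rightarrow> real) \<Rightarrow> ('a \<Rightarrow> real) \<Rightarrow> real" where
  "L2_inner M f g = (\<integral>x. f x * g x \<partial>M)"


section \<open>Unbounded operators on \<open>L\<^sup>2\<close>\<close>

text \<open>
  A possibly unbounded operator is given by its graph, a set of pairs \<open>(f, A f)\<close>. The graph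
  contains all representatives of its elements, so its first projection \<open>Domain A\<close> is the
  operator domain. A self-adjoint graph, being equal to its adjoint, is automatically linear
  and closed under almost everywhere equality; as the domain is dense, it is also
  single-valued up to almost everywhere equality.
\<close>

type_synonym 'a graph = "(('a \<Rightarrow> real) \<times> ('a \<Rightarrow> real)) set"

definition adjoint_graph :: "'a measure \<Rightarrow> 'a graph \<Rightarrow> 'a graph" where
  "adjoint_graph M A = {(g, h). g \<in> Lp M 2 \<and> h \<in> Lp M 2 \<and>
     (\<forall>(f, k) \<in> A. L2_inner M k g = L2_inner M f h)}"

definition densely_defined :: "'a measure \<Rightarrow> 'a graph \<Rightarrow> bool" where
  "densely_defined M A \<longleftrightarrow>
     (\<forall>f \<in> Lp M 2. \<forall>e > 0. \<exists>g \<in> Domain A. Lp_norm M 2 (\<lambda>x. f x - g x) < e)"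

definition nonneg_selfadjoint :: "'a measure \<Rightarrow> 'a graph \<Rightarrow> bool" where
  "nonneg_selfadjoint M A \<longleftrightarrow>
     densely_defined M A \<and> adjoint_graph M A = A \<and> (\<forall>(f, h) \<in> A. 0 \<le> L2_inner M h f)"

text \<open>
  The square root of a nonnegative self-adjoint operator \<open>A\<close> is the unique nonnegative
  self-adjoint operator \<open>S\<close> with \<open>S S = A\<close>, including equality of domains.
\<close>

definition is_sqrt_of :: "'a measure \<Rightarrow> 'a graph \<Rightarrow> 'a graph \<Rightarrow> bool" where
  "is_sqrt_of M S A \<longleftrightarrow> nonneg_selfadjoint M S \<and> S O S = A"

text \<open>\<open>Q(f) = (S f, S f)\<close> where \<open>S\<close> is the graph of the square root of \<open>A\<close>; the choice of the
  representative of \<open>S f\<close> is immaterial.\<close>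

definition quad_form :: "'a measure \<Rightarrow> 'a graph \<Rightarrow> ('a \<Rightarrow> real) \<Rightarrow> real" where
  "quad_form M S f = (let h = (SOME h. (f, h) \<in> S) in L2_inner M h h)"


section \<open>Symmetric submarkovian semigroups\<close>

definition L2_linear :: "'a measure \<Rightarrow> (('a \<Rightarrow> real) \<Rightarrow> 'a \<Rightarrow> real) \<Rightarrow> bool" where
  "L2_linear M P \<longleftrightarrow>
     (\<forall>f \<in> Lp M 2. P f \<in> Lp M 2) \<and>
     (\<forall>f \<in> Lp M 2. \<forall>g \<in> Lp M 2. \<forall>a b. AE x in M.
        P (\<lambda>x. a * f x + b * g x) x = a * P f x + b * P g x)"

definition submarkovian :: "'a measure \<Rightarrow> (('a \<Rightarrow> real) \<Rightarrow> 'a \<Rightarrow> real) \<Rightarrow> bool" where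
  "submarkovian M P \<longleftrightarrow>
     (\<forall>f \<in> Lp M 2. (AE x in M. 0 \<le> f x) \<longrightarrow> (AE x in M. 0 \<le> P f x)) \<and>
     (\<forall>p. 1 \<le> p \<longrightarrow> (\<forall>f \<in> Lp M 2 \<inter> Lp M p.
        P f \<in> Lp M p \<and> Lp_norm M p (P f) \<le> Lp_norm M p f))"

definition symmetric_submarkovian_semigroup ::
    "'a measure \<Rightarrow> (real \<Rightarrow> ('a \<Rightarrow> real) \<Rightarrow> 'a \<Rightarrow> real) \<Rightarrow> bool" where
  "symmetric_submarkovian_semigroup M T \<longleftrightarrow>
     (\<forall>t \<ge> 0. L2_linear M (T t) \<and> submarkovian M (T t)) \<and>
     (\<forall>t \<ge> 0. \<forall>f \<in> Lp M 2. \<forall>g \<in> Lp M 2. L2_inner M (T t f) g = L2_inner M f (T t g)) \<and>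
     (\<forall>f \<in> Lp M 2. AE x in M. T 0 f x = f x) \<and>
     (\<forall>s \<ge> 0. \<forall>t \<ge> 0. \<forall>f \<in> Lp M 2. AE x in M. T (s + t) f x = T s (T t f) x) \<and>
     (\<forall>f \<in> Lp M 2. ((\<lambda>t. Lp_norm M 2 (\<lambda>x. T t f x - f x)) \<longlongrightarrow> 0) (at_right 0))"

text \<open>
  The operator \<open>A\<close> with \<open>T t = exp (- t A)\<close>: note the sign, \<open>A f\<close> is the limit in \<open>L\<^sup>2\<close> of
  \<open>(f - T t f) / t\<close> as \<open>t\<close> decreases to \<open>0\<close>.
\<close>

definition generator :: "'a measure \<Rightarrow> (real \<Rightarrow> ('a \<Rightarrow> real) \<Rightarrow> 'a \<Rightarrow> real) \<Rightarrow> 'a graph" where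
  "generator M T = {(f, h). f \<in> Lp M 2 \<and> h \<in> Lp M 2 \<and>
     ((\<lambda>t. Lp_norm M 2 (\<lambda>x. (f x - T t f x) / t - h x)) \<longlongrightarrow> 0) (at_right 0)}"

text \<open>
  An operator on \<open>L\<^sup>2\<close> that contracts the \<open>L\<^sup>1\<close> norm extends uniquely by continuity from
  \<open>L\<^sup>1 \<inter> L\<^sup>2\<close> to \<open>L\<^sup>1\<close>; the following is (a representative of) the value of the extension at \<open>f\<close>.
\<close>

definition L1_extension ::
    "'a measure \<Rightarrow> (('a \<Rightarrow> real) \<Rightarrow> 'a \<Rightarrow> real) \<Rightarrow> ('a \<Rightarrow> real) \<Rightarrow> 'a \<Rightarrow> real" where
  "L1_extension M P f = (SOME g. g \<in> Lp M 1 \<and>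
     (\<exists>u. (\<forall>n::nat. u n \<in> Lp M 1 \<inter> Lp M 2) \<and>
        (\<lambda>n. Lp_norm M 1 (\<lambda>x. u n x - f x)) \<longlonglongrightarrow> 0 \<and>
        (\<lambda>n. Lp_norm M 1 (\<lambda>x. P (u n) x - g x)) \<longlonglongrightarrow> 0))"


section \<open>The functions \<open>B\<close> and \<open>q\<close>\<close>

definition B_fun :: "(real \<Rightarrow> real) \<Rightarrow> real \<Rightarrow> ereal" where
  "B_fun \<beta> y = (SUP t \<in> {0<..}. ereal (t * y / 2 - t * \<beta> (1 / t)))"

text \<open>
  The reciprocal is taken in \<open>[0, \<infinity>]\<close>: it is \<open>0\<close> where \<open>B = \<infinity>\<close> and \<open>\<infinity>\<close> where \<open>B \<le> 0\<close>. As \<open>B\<close>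
  is nondecreasing, \<open>q s = \<infinity>\<close> as soon as \<open>B y \<le> 0\<close> for some \<open>y > s\<close>.
\<close>

definition q_fun :: "(real \<Rightarrow> real) \<Rightarrow> real \<Rightarrow> ennreal" where
  "q_fun \<beta> s = (\<integral>\<^sup>+ y \<in> {s..}. inverse (e2ennreal (B_fun \<beta> y)) \<partial>lborel)"

text \<open>
  \<open>m\<close> is the inverse function of \<open>q\<close>, defined on the positive reals: for \<open>t > 0\<close> the equation
  \<open>q s = t\<close> has \<open>s = m t\<close> as its one and only solution.
\<close>

definition is_inverse_fun :: "(real \<Rightarrow> ennreal) \<Rightarrow> (real \<Rightarrow> real) \<Rightarrow> bool" where
  "is_inverse_fun q m \<longleftrightarrow> (\<forall>t > 0. \<forall>s. q s = ennreal t \<longleftrightarrow> s = m t)"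

end

theory Submission
  imports Defs
begin

text \<open>
  By Jensen's inequality the logarithmic Sobolev inequality becomes the Nash type inequality
  \<open>N B (ln N) \<le> Q u\<close> for \<open>N = \<parallel>u\<parallel>\<^sub>2\<^sup>2\<close>, \<open>\<parallel>u\<parallel>\<^sub>1 \<le> 1\<close>. Applied to \<open>u = T t f\<close> it is a differential
  inequality for \<open>t \<mapsto> ln \<parallel>T t f\<parallel>\<^sub>2\<^sup>2\<close>, whose integration bounds \<open>T t\<close> from \<open>L\<^sup>1\<close> to \<open>L\<^sup>2\<close> by
  \<open>exp (M (2 t) / 2)\<close>; duality and the semigroup law give the bound from \<open>L\<^sup>1\<close> to \<open>L\<^sup>\<infinity>\<close>.
  In place of the spectral theorem, all regularity of the semigroup is read off the correlation
  function \<open>s \<mapsto> (T s f, f)\<close>, whose successive finite differences alternate in sign.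
\<close>

section \<open>Lebesgue spaces\<close>

text \<open>Otherwise the simplifier rewrites \<open>Lp M 2\<close> to \<open>Lp M (ereal 2)\<close>.\<close>
declare numeral_eq_ereal [simp del]

text \<open>No control of N at time 0 is required. The time 2 \<tau> is spent between
  \<open>ln N\<close> at times \<tau> and 0, and the part of the integral \<open>q\<close> beyond
  the initial value only helps. So \<open>q\<close> at \<open>ln N\<close> is at least 2 \<tau>
  whatever the L2 norm of f, and finiteness of \<open>q\<close> turns this into a bound that sees
  only the L1 norm. The factor 2 arises because N is quadratic, N' = - 2 Q; halving the time in the
  last step cancels it, as each half contributes exp (M t / 2).

  Two obstacles shape the argument. The logarithmic Sobolev inequality speaks only of functions in
  the form domain, while f is arbitrary, so a smoothing estimate must first place T t f there. And B
  is merely monotone with extended real values, so the differential inequality is kept as a chord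
  estimate between two times and never differentiated.\<close>

lemma Lp2_iff: "f \<in> Lp M 2 \<longleftrightarrow> f \<in> borel_measurable M \<and> integrable M (\<lambda>x. (f x)\<^sup>2)"
  by (simp add: Lp_def numeral_eq_ereal)

lemma Lp1_iff: "f \<in> Lp M 1 \<longleftrightarrow> integrable M f"
  by (auto simp: Lp_def integrable_norm_iff[where 'b=real, unfolded real_norm_def])

lemma Lp_inf_iff: "f \<in> Lp M \<infinity> \<longleftrightarrow> f \<in> borel_measurable M \<and> (\<exists>C. AE x in M. \<bar>f x\<bar> \<le> C)"
  by (simp add: Lp_def)

lemma Lp_measurable: "f \<in> Lp M p \<Longrightarrow> f \<in> borel_measurable M"
  by (simp add: Lp_def)

lemma Lp_norm_2: "Lp_norm M 2 f = sqrt (L2_inner M f f)"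
proof -
  have "0 \<le> (\<integral>x. f x * f x \<partial>M)" by simp
  then show ?thesis
    by (simp add: Lp_norm_def L2_inner_def numeral_eq_ereal power2_eq_square powr_half_sqrt)
qed

lemma Lp_norm_1: "Lp_norm M 1 f = (\<integral>x. \<bar>f x\<bar> \<partial>M)"
  by (simp add: Lp_norm_def)

lemma L2_inner_commute: "L2_inner M f g = L2_inner M g f"
  by (simp add: L2_inner_def mult.commute)

lemma L2_inner_self_nonneg [simp]: "0 \<le> L2_inner M f f"
  by (simp add: L2_inner_def)

lemma L2_inner_integrable:
  assumes "f \<in> Lp M 2" "g \<in> Lp M 2"
  shows "integrable M (\<lambda>x. f x * g x)"
proof (rule Bochner_Integration.integrable_bound)
  show "integrable M (\<lambda>x. (f x)\<^sup>2 + (g x)\<^sup>2)" "(\<lambda>x. f x * g x) \<in> borel_measurable M"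
    using assms by (auto simp: Lp2_iff)
  have "\<bar>a * b\<bar> \<le> a\<^sup>2 + b\<^sup>2" for a b :: real
  proof -
    have "0 \<le> (\<bar>a\<bar> - \<bar>b\<bar>)\<^sup>2" "0 \<le> a\<^sup>2 + b\<^sup>2" by auto
    then have "2 * (\<bar>a\<bar> * \<bar>b\<bar>) \<le> a\<^sup>2 + b\<^sup>2" by (simp add: power2_diff)
    then show ?thesis using \<open>0 \<le> a\<^sup>2 + b\<^sup>2\<close> unfolding abs_mult by linarith
  qed
  then show "AE x in M. norm (f x * g x) \<le> norm ((f x)\<^sup>2 + (g x)\<^sup>2)"
    by simp
qed

lemma Lp2_lincomb:
  assumes "f \<in> Lp M 2" "g \<in> Lp M 2"
  shows "(\<lambda>x. a * f x + b * g x) \<in> Lp M 2"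
proof -
  have "integrable M (\<lambda>x. a\<^sup>2 * (f x)\<^sup>2 + 2 * a * b * (f x * g x) + b\<^sup>2 * (g x)\<^sup>2)"
    using assms L2_inner_integrable[OF assms] by (intro Bochner_Integration.integrable_add) (auto simp: Lp2_iff)
  also have "(\<lambda>x. a\<^sup>2 * (f x)\<^sup>2 + 2 * a * b * (f x * g x) + b\<^sup>2 * (g x)\<^sup>2)
      = (\<lambda>x. (a * f x + b * g x)\<^sup>2)"
    by (auto simp: power2_eq_square algebra_simps)
  finally show ?thesis using assms by (auto simp: Lp2_iff)
qed

lemma Lp2_scale: "f \<in> Lp M 2 \<Longrightarrow> (\<lambda>x. a * f x) \<in> Lp M 2"
  using Lp2_lincomb[of f M f a 0] by simp

lemma Lp2_diff: "f \<in> Lp M 2 \<Longrightarrow> g \<in> Lp M 2 \<Longrightarrow> (\<lambda>x. f x - g x) \<in> Lp M 2"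
  using Lp2_lincomb[of f M g 1 "-1"] by simp

lemma Lp2_mono:
  assumes "g \<in> Lp M 2" "f \<in> borel_measurable M" "AE x in M. \<bar>f x\<bar> \<le> \<bar>g x\<bar>"
  shows "f \<in> Lp M 2"
proof -
  have "integrable M (\<lambda>x. (f x)\<^sup>2)"
  proof (rule Bochner_Integration.integrable_bound)
    show "integrable M (\<lambda>x. (g x)\<^sup>2)" "(\<lambda>x. (f x)\<^sup>2) \<in> borel_measurable M"
      using assms by (auto simp: Lp2_iff)
    show "AE x in M. norm ((f x)\<^sup>2) \<le> norm ((g x)\<^sup>2)"
      using assms(3) by eventually_elim (simp add: abs_le_square_iff)
  qed
  then show ?thesis using assms by (simp add: Lp2_iff)
qed

lemma Lp2_abs: "f \<in> Lp M 2 \<Longrightarrow> (\<lambda>x. \<bar>f x\<bar>) \<in> Lp M 2"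
  by (rule Lp2_mono[of f]) (auto intro: borel_measurable_abs Lp_measurable)

lemma L2_inner_lincomb:
  assumes "f \<in> Lp M 2" "g \<in> Lp M 2" "h \<in> Lp M 2"
  shows "L2_inner M (\<lambda>x. a * f x + b * g x) h = a * L2_inner M f h + b * L2_inner M g h"
proof -
  have "L2_inner M (\<lambda>x. a * f x + b * g x) h = (\<integral>x. a * (f x * h x) + b * (g x * h x) \<partial>M)"
    by (simp add: L2_inner_def algebra_simps)
  also have "\<dots> = a * L2_inner M f h + b * L2_inner M g h"
    using L2_inner_integrable[of f M h] L2_inner_integrable[of g M h] assms
    by (simp add: L2_inner_def)
  finally show ?thesis .
qed

lemma L2_inner_diff:
  assumes "f \<in> Lp M 2" "g \<in> Lp M 2" "h \<in> Lp M 2"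
  shows "L2_inner M (\<lambda>x. f x - g x) h = L2_inner M f h - L2_inner M g h"
    and "L2_inner M h (\<lambda>x. f x - g x) = L2_inner M h f - L2_inner M h g"
  using L2_inner_lincomb[OF assms, of 1 "-1"] by (simp_all add: L2_inner_commute[of M h])

lemma L2_inner_cong_AE:
  assumes "AE x in M. f x = f' x" "f \<in> borel_measurable M" "f' \<in> borel_measurable M"
    "g \<in> borel_measurable M"
  shows "L2_inner M f g = L2_inner M f' g" "L2_inner M g f = L2_inner M g f'"
proof -
  show "L2_inner M f g = L2_inner M f' g"
    unfolding L2_inner_def using assms by (intro integral_cong_AE) auto
  then show "L2_inner M g f = L2_inner M g f'" by (simp add: L2_inner_commute)
qed

lemma L2_inner_self_eq_0:
  assumes "f \<in> Lp M 2" "L2_inner M f f = 0"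
  shows "AE x in M. f x = 0"
proof -
  have "AE x in M. f x * f x = 0"
    using assms L2_inner_integrable[OF assms(1,1)]
    by (subst (asm) L2_inner_def) (subst (asm) integral_nonneg_eq_0_iff_AE, auto)
  then show ?thesis by simp
qed

lemma L2_inner_Cauchy_Schwarz:
  assumes f: "f \<in> Lp M 2" and g: "g \<in> Lp M 2"
  shows "\<bar>L2_inner M f g\<bar> \<le> Lp_norm M 2 f * Lp_norm M 2 g"
proof -
  define a b c where "a = L2_inner M f f" and "b = L2_inner M f g" and "c = L2_inner M g g"
  have poly: "0 \<le> r\<^sup>2 * a + 2 * r * s * b + s\<^sup>2 * c" for r s
  proof -
    let ?w = "\<lambda>x. r * f x + s * g x"
    have w: "?w \<in> Lp M 2" by (rule Lp2_lincomb[OF f g])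
    have "L2_inner M ?w ?w = r * L2_inner M f ?w + s * L2_inner M g ?w"
      by (rule L2_inner_lincomb[OF f g w])
    also have "L2_inner M f ?w = r * a + s * b"
      using L2_inner_lincomb[OF f g f, of r s] by (simp add: L2_inner_commute a_def b_def)
    also have "L2_inner M g ?w = r * b + s * c"
      using L2_inner_lincomb[OF f g g, of r s] by (simp add: L2_inner_commute c_def b_def)
    finally have "L2_inner M ?w ?w = r\<^sup>2 * a + 2 * r * s * b + s\<^sup>2 * c"
      by (simp add: power2_eq_square algebra_simps)
    then show ?thesis by (metis L2_inner_self_nonneg)
  qed
  have a0: "0 \<le> a" and c0: "0 \<le> c" by (simp_all add: a_def c_def)
  have "b\<^sup>2 \<le> a * c"
  proof (cases "a = 0")
    case True
    have "b = 0"
    proof (rule ccontr)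
      assume "b \<noteq> 0"
      \<comment> \<open>With a = 0 and s = 1 the form is 2 r b + c, and this r makes it equal to
        -1.\<close>
      then show False using poly[of "- (c + 1) / (2 * b)" 1] True by (simp add: field_simps)
    qed
    then show ?thesis using True by simp
  next
    case False
    \<comment> \<open>The ratio r / s = - b / a minimises the form; clearing the denominator gives
      these arguments.\<close>
    have "0 \<le> a * (a * c - b\<^sup>2)"
      using poly[of "- b" a] by (simp add: power2_eq_square algebra_simps)
    then show ?thesis using False a0 by (simp add: zero_le_mult_iff)
  qed
  then have "\<bar>b\<bar> \<le> sqrt (a * c)" by (metis real_sqrt_abs real_sqrt_le_iff)
  then show ?thesis by (simp add: Lp_norm_2 a_def b_def c_def real_sqrt_mult)
qed

lemma L2_inner_tendsto:
  assumes conv: "((\<lambda>t. Lp_norm M 2 (\<lambda>x. F t x - h x)) \<longlongrightarrow> 0) net"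
    and F: "\<And>t. F t \<in> Lp M 2" and h: "h \<in> Lp M 2" and v: "v \<in> Lp M 2"
  shows "((\<lambda>t. L2_inner M (F t) v) \<longlongrightarrow> L2_inner M h v) net"
proof (rule Lim_null[THEN iffD2], rule tendsto_rabs_zero_cancel, rule tendsto_sandwich)
  show "\<forall>\<^sub>F t in net. 0 \<le> \<bar>L2_inner M (F t) v - L2_inner M h v\<bar>" by simp
  show "\<forall>\<^sub>F t in net. \<bar>L2_inner M (F t) v - L2_inner M h v\<bar>
      \<le> Lp_norm M 2 (\<lambda>x. F t x - h x) * Lp_norm M 2 v"
    using L2_inner_Cauchy_Schwarz[OF Lp2_diff[OF F h] v] L2_inner_diff(1)[OF F h v] by simp
  show "((\<lambda>t. Lp_norm M 2 (\<lambda>x. F t x - h x) * Lp_norm M 2 v) \<longlongrightarrow> 0) net"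
    using tendsto_mult_right[OF conv] by simp
qed simp

section \<open>Limits of rapidly converging sequences in L1 and L2\<close>

lemma geometric_series_integrable:
  fixes e :: "nat \<Rightarrow> 'a \<Rightarrow> real"
  assumes int: "\<And>n. integrable M (e n)" and nn: "\<And>n x. 0 \<le> e n x"
    and bound: "\<And>n. (\<integral>x. e n x \<partial>M) \<le> C * (1/2) ^ n"
  shows "AE x in M. summable (\<lambda>n. e n x)" and "integrable M (\<lambda>x. \<Sum>n. e n x)"
proof -
  have sums: "summable (\<lambda>n. \<integral>x. norm (e n x) \<partial>M)"
  proof (rule summable_comparison_test')
    show "summable (\<lambda>n. C * (1/2::real) ^ n)" by (intro summable_mult summable_geometric) simp
    show "norm (\<integral>x. norm (e n x) \<partial>M) \<le> C * (1/2) ^ n" for n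
      using bound[of n] nn by (simp add: integral_nonneg)
  qed
  have "(\<integral>\<^sup>+x. (\<Sum>n. ennreal (e n x)) \<partial>M) = (\<Sum>n. \<integral>\<^sup>+x. ennreal (e n x) \<partial>M)"
    using int by (intro nn_integral_suminf) auto
  also have "\<dots> = (\<Sum>n. ennreal (\<integral>x. e n x \<partial>M))"
    using int nn by (simp add: nn_integral_eq_integral)
  also have "\<dots> \<noteq> \<infinity>"
    using sums nn by (simp add: ennreal_suminf_neq_top integral_nonneg)
  finally have "AE x in M. (\<Sum>n. ennreal (e n x)) \<noteq> \<infinity>"
    using int by (intro nn_integral_PInf_AE) auto
  then show *: "AE x in M. summable (\<lambda>n. e n x)"
    by eventually_elim (use nn in \<open>auto intro: summable_suminf_not_top\<close>)
  then show "integrable M (\<lambda>x. \<Sum>n. e n x)"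
    using int sums nn by (intro integrable_suminf) auto
qed

text \<open>The bound holds for all n at once and so provides the majorant for dominated
  convergence.\<close>

lemma telescoping_bound:
  fixes u :: "nat \<Rightarrow> real"
  assumes "summable d" and d: "\<And>n. \<bar>u (Suc n) - u n\<bar> \<le> d n"
  shows "convergent u" and "\<bar>u n\<bar> \<le> \<bar>u 0\<bar> + suminf d"
proof -
  have "summable (\<lambda>n. u (Suc n) - u n)"
    by (rule summable_comparison_test'[OF assms(1)]) (use d in auto)
  then have "convergent (\<lambda>n. \<Sum>i<n. u (Suc i) - u i)" by (simp add: summable_iff_convergent)
  then have "convergent (\<lambda>n. u n - u 0)" by (simp add: sum_lessThan_telescope)
  from convergent_add[OF this convergent_const[of "u 0"]] show "convergent u" by simp
  have "\<bar>u n - u 0\<bar> = \<bar>\<Sum>i<n. u (Suc i) - u i\<bar>" by (simp add: sum_lessThan_telescope)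
  also have "\<dots> \<le> (\<Sum>i<n. d i)" using d by (intro order_trans[OF sum_abs] sum_mono)
  also have "\<dots> \<le> suminf d"
    using d by (intro sum_le_suminf assms) (auto intro: order_trans[OF abs_ge_zero])
  finally show "\<bar>u n\<bar> \<le> \<bar>u 0\<bar> + suminf d" by linarith
qed

lemma L1_geometric_limit:
  fixes u :: "nat \<Rightarrow> 'a \<Rightarrow> real"
  assumes u: "\<And>n. integrable M (u n)"
    and bound: "\<And>n. (\<integral>x. \<bar>u (Suc n) x - u n x\<bar> \<partial>M) \<le> C * (1/2) ^ n"
  obtains g where "integrable M g" "(\<lambda>n. \<integral>x. \<bar>u n x - g x\<bar> \<partial>M) \<longlonglongrightarrow> 0"
proof -
  note [measurable] = borel_measurable_integrable[OF u]
  let ?d = "\<lambda>n x. \<bar>u (Suc n) x - u n x\<bar>"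
  have d: "integrable M (?d n)" for n using u by auto
  note ser = geometric_series_integrable[OF d _ bound, simplified]
  \<comment> \<open>\<open>lim\<close> is total and preserves measurability; its arbitrary value
    where the sequence diverges concerns only a null set.\<close>
  define g where "g = (\<lambda>x. lim (\<lambda>n. u n x))"
  have [measurable]: "g \<in> borel_measurable M" by (simp add: g_def)
  define H where "H = (\<lambda>x. \<bar>u 0 x\<bar> + (\<Sum>n. ?d n x))"
  have H: "integrable M H" unfolding H_def using u ser(2) by auto
  have conv: "AE x in M. (\<lambda>n. u n x) \<longlonglongrightarrow> g x \<and> (\<forall>n. \<bar>u n x\<bar> \<le> H x)"
    using ser(1)
  proof eventually_elim
    case (elim x)
    then show ?case
      using telescoping_bound[of "\<lambda>n. ?d n x" "\<lambda>n. u n x"]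
      by (auto simp: g_def H_def convergent_LIMSEQ_iff)
  qed
  have gH: "AE x in M. \<bar>g x\<bar> \<le> H x"
    using conv
  proof eventually_elim
    case (elim x)
    then show ?case by (intro Lim_bounded[OF tendsto_rabs]) auto
  qed
  have g: "integrable M g"
    by (rule Bochner_Integration.integrable_bound[OF H]) (use gH in auto)
  have "(\<lambda>n. \<integral>x. \<bar>u n x - g x\<bar> \<partial>M) \<longlonglongrightarrow> (\<integral>x. 0 \<partial>M)"
  proof (rule integral_dominated_convergence)
    show "integrable M (\<lambda>x. 2 * H x)" using H by simp
    show "AE x in M. (\<lambda>n. \<bar>u n x - g x\<bar>) \<longlonglongrightarrow> 0"
      using conv
      by eventually_elim (auto intro: tendsto_rabs_zero LIM_zero)
    show "AE x in M. norm \<bar>u n x - g x\<bar> \<le> 2 * H x" for n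
      using conv gH
    proof eventually_elim
      case (elim x)
      then have "\<bar>u n x\<bar> \<le> H x" "\<bar>g x\<bar> \<le> H x" by blast+
      then show ?case by simp
    qed
  qed auto
  with g show thesis by (intro that) auto
qed

text \<open>The squared increments decay like 4^-n, so they remain summable after multiplication by
  2^n. Each increment is then at most (sqrt (1/2))^n times the square root of one integrable
  function S, and the whole sequence has an L2 majorant. Weak convergence is all that membership in
  an adjoint graph tests.\<close>

lemma L2_geometric_weak_limit:
  fixes u :: "nat \<Rightarrow> 'a \<Rightarrow> real"
  assumes u: "\<And>n. u n \<in> Lp M 2"
    and bound: "\<And>n. (\<integral>x. (u (Suc n) x - u n x)\<^sup>2 \<partial>M) \<le> C * (1/4) ^ n"
  obtains h where "h \<in> Lp M 2" "\<And>v. v \<in> Lp M 2 \<Longrightarrow> (\<lambda>n. L2_inner M (u n) v) \<longlonglongrightarrow> L2_inner M h v"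
proof -
  note [measurable] = Lp_measurable[OF u]
  let ?e = "\<lambda>n x. 2 ^ n * (u (Suc n) x - u n x)\<^sup>2"
  have e: "integrable M (?e n)" for n
    using Lp2_diff[OF u u] by (simp add: Lp2_iff)
  have ebound: "(\<integral>x. ?e n x \<partial>M) \<le> C * (1/2) ^ n" for n
  proof -
    have "(\<integral>x. ?e n x \<partial>M) \<le> 2 ^ n * (C * (1/4) ^ n)"
      using bound[of n] by simp
    also have "\<dots> = C * (2 * (1/4)) ^ n" by (simp only: power_mult_distrib mult_ac)
    finally show ?thesis by simp
  qed
  note ser = geometric_series_integrable[OF e _ ebound, simplified]
  define g where "g = (\<lambda>x. lim (\<lambda>n. u n x))"
  have [measurable]: "g \<in> borel_measurable M" by (simp add: g_def)
  define S where "S = (\<lambda>x. \<Sum>n. ?e n x)"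
  define c :: real where "c = (\<Sum>n. sqrt (1/2) ^ n)"
  have cs: "summable (\<lambda>n. sqrt (1/2) ^ n :: real)"
    by (rule summable_geometric) (simp add: real_sqrt_divide)
  define H where "H = (\<lambda>x. \<bar>u 0 x\<bar> + c * sqrt \<bar>S x\<bar>)"
  have [measurable]: "S \<in> borel_measurable M" by (simp add: S_def)
  have "(\<lambda>x. sqrt \<bar>S x\<bar>) \<in> Lp M 2"
    using ser(2) by (auto simp: Lp2_iff S_def[symmetric])
  moreover have "(\<lambda>x. \<bar>u 0 x\<bar>) \<in> Lp M 2" using u[of 0] by (simp add: Lp2_iff)
  ultimately have H: "H \<in> Lp M 2"
    using Lp2_lincomb[of "\<lambda>x. \<bar>u 0 x\<bar>" M "\<lambda>x. sqrt \<bar>S x\<bar>" 1 c] by (simp add: H_def)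
  have conv: "AE x in M. (\<lambda>n. u n x) \<longlonglongrightarrow> g x \<and> (\<forall>n. \<bar>u n x\<bar> \<le> H x)"
    using ser(1)
  proof eventually_elim
    case (elim x)
    have S0: "0 \<le> S x" unfolding S_def by (intro suminf_nonneg elim) auto
    have d: "\<bar>u (Suc n) x - u n x\<bar> \<le> sqrt \<bar>S x\<bar> * sqrt (1/2) ^ n" for n
    proof -
      have "?e n x \<le> S x" unfolding S_def
        using sum_le_suminf[OF elim, of "{n}"] by simp
      then have "(u (Suc n) x - u n x)\<^sup>2 \<le> S x * (1/2) ^ n"
        by (simp add: power_divide field_simps)
      then have "sqrt ((u (Suc n) x - u n x)\<^sup>2) \<le> sqrt (S x * (1/2) ^ n)"
        by (rule real_sqrt_le_mono)
      also have "\<dots> = sqrt \<bar>S x\<bar> * sqrt (1/2) ^ n"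
        using S0 by (simp add: real_sqrt_mult real_sqrt_power)
      finally show ?thesis by (simp only: real_sqrt_abs)
    qed
    have sd: "summable (\<lambda>n. sqrt \<bar>S x\<bar> * sqrt (1/2) ^ n)" by (intro summable_mult cs)
    have "(\<Sum>n. sqrt \<bar>S x\<bar> * sqrt (1/2) ^ n) = c * sqrt \<bar>S x\<bar>"
      unfolding c_def by (subst suminf_mult[OF cs]) simp
    then show ?case
      using telescoping_bound[OF sd, of "\<lambda>n. u n x"] d
      by (auto simp: g_def H_def convergent_LIMSEQ_iff)
  qed
  have gH: "AE x in M. \<bar>g x\<bar> \<le> H x"
    using conv
  proof eventually_elim
    case (elim x)
    then show ?case by (intro Lim_bounded[OF tendsto_rabs]) auto
  qed
  have g: "g \<in> Lp M 2"
    by (rule Lp2_mono[OF H]) (use gH in \<open>auto elim: eventually_mono\<close>)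
  have "(\<lambda>n. L2_inner M (u n) v) \<longlonglongrightarrow> L2_inner M g v" if v: "v \<in> Lp M 2" for v
    unfolding L2_inner_def
  proof (rule integral_dominated_convergence)
    note [measurable] = Lp_measurable[OF v]
    show "(\<lambda>x. g x * v x) \<in> borel_measurable M" "(\<lambda>x. u n x * v x) \<in> borel_measurable M" for n
      by auto
    show "integrable M (\<lambda>x. \<bar>H x * v x\<bar>)" using L2_inner_integrable[OF H v] by simp
    show "AE x in M. (\<lambda>n. u n x * v x) \<longlonglongrightarrow> g x * v x"
      using conv by eventually_elim (auto intro: tendsto_mult_right)
    show "AE x in M. norm (u n x * v x) \<le> \<bar>H x * v x\<bar>" for n
      using conv
    proof eventually_elim
      case (elim x)
      then have "\<bar>u n x\<bar> \<le> \<bar>H x\<bar>" by (meson abs_ge_self order_trans)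
      then show ?case by (simp add: abs_mult mult_right_mono)
    qed
  qed
  with g show thesis by (rule that)
qed

section \<open>Symmetric contraction semigroups\<close>

locale sym_submarkovian =
  fixes M :: "'a measure" and T :: "real \<Rightarrow> ('a \<Rightarrow> real) \<Rightarrow> 'a \<Rightarrow> real"
  assumes semigroup: "symmetric_submarkovian_semigroup M T"
begin

lemma T_Lp2: "0 \<le> t \<Longrightarrow> f \<in> Lp M 2 \<Longrightarrow> T t f \<in> Lp M 2"
  using semigroup by (simp add: symmetric_submarkovian_semigroup_def L2_linear_def)

lemma T_measurable: "0 \<le> t \<Longrightarrow> f \<in> Lp M 2 \<Longrightarrow> T t f \<in> borel_measurable M"
  by (rule Lp_measurable[OF T_Lp2])

lemma T_lincomb:
  "0 \<le> t \<Longrightarrow> f \<in> Lp M 2 \<Longrightarrow> g \<in> Lp M 2 \<Longrightarrow>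
    AE x in M. T t (\<lambda>x. a * f x + b * g x) x = a * T t f x + b * T t g x"
  using semigroup by (simp add: symmetric_submarkovian_semigroup_def L2_linear_def)

lemma T_diff:
  "0 \<le> t \<Longrightarrow> f \<in> Lp M 2 \<Longrightarrow> g \<in> Lp M 2 \<Longrightarrow>
    AE x in M. T t (\<lambda>x. f x - g x) x = T t f x - T t g x"
  using T_lincomb[of t f g 1 "-1"] by simp

lemma T_scale:
  "0 \<le> t \<Longrightarrow> f \<in> Lp M 2 \<Longrightarrow> AE x in M. T t (\<lambda>x. a * f x) x = a * T t f x"
  using T_lincomb[of t f f a 0] by simp

lemma T_symmetric:
  "0 \<le> t \<Longrightarrow> f \<in> Lp M 2 \<Longrightarrow> g \<in> Lp M 2 \<Longrightarrow>
    L2_inner M (T t f) g = L2_inner M f (T t g)"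
  using semigroup by (simp add: symmetric_submarkovian_semigroup_def)

lemma T_0: "f \<in> Lp M 2 \<Longrightarrow> AE x in M. T 0 f x = f x"
  using semigroup by (simp add: symmetric_submarkovian_semigroup_def)

lemma T_add:
  "0 \<le> s \<Longrightarrow> 0 \<le> t \<Longrightarrow> f \<in> Lp M 2 \<Longrightarrow> AE x in M. T (s + t) f x = T s (T t f) x"
  using semigroup by (simp add: symmetric_submarkovian_semigroup_def)

lemma T_pos:
  "0 \<le> t \<Longrightarrow> f \<in> Lp M 2 \<Longrightarrow> AE x in M. 0 \<le> f x \<Longrightarrow> AE x in M. 0 \<le> T t f x"
  using semigroup by (simp add: symmetric_submarkovian_semigroup_def submarkovian_def)

lemma T_Lp:
  assumes "0 \<le> t" "f \<in> Lp M 2" "f \<in> Lp M p" "1 \<le> p"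
  shows "T t f \<in> Lp M p" and "Lp_norm M p (T t f) \<le> Lp_norm M p f"
  using semigroup assms by (auto simp: symmetric_submarkovian_semigroup_def submarkovian_def)

lemma T_inner_contraction:
  assumes "0 \<le> t" "f \<in> Lp M 2"
  shows "L2_inner M (T t f) (T t f) \<le> L2_inner M f f"
proof -
  have "Lp_norm M 2 (T t f) \<le> Lp_norm M 2 f"
    by (rule T_Lp) (use assms in \<open>auto simp: numeral_eq_ereal\<close>)
  then show ?thesis by (simp add: Lp_norm_2)
qed

text \<open>Inner products of orbit elements depend only on the total time, so everything reduces to
  functions of one variable.\<close>

lemma inner_T_T:
  assumes "0 \<le> s" "0 \<le> r" "f \<in> Lp M 2" "g \<in> Lp M 2"
  shows "L2_inner M (T s f) (T r g) = L2_inner M (T (s + r) f) g"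
proof -
  have "L2_inner M (T s f) (T r g) = L2_inner M (T r (T s f)) g"
    using T_symmetric[OF \<open>0 \<le> r\<close> T_Lp2[OF \<open>0 \<le> s\<close>]] assms by simp
  also have "\<dots> = L2_inner M (T (r + s) f) g"
    using T_add[of r s f] assms
    by (intro L2_inner_cong_AE) (auto intro!: Lp_measurable[OF T_Lp2] T_Lp2 Lp_measurable)
  finally show ?thesis by (simp add: add.commute)
qed

section \<open>The correlation function and its finite differences\<close>

definition corr :: "('a \<Rightarrow> real) \<Rightarrow> real \<Rightarrow> real" where
  "corr f s = L2_inner M (T s f) f"

text \<open>In spectral terms \<open>corr f\<close> is the Laplace transform of the spectral measure
  of f, and \<open>incr k\<close> multiplies that measure by (1 - exp (- k \<lambda>))^2.\<close>

definition incr :: "real \<Rightarrow> ('a \<Rightarrow> real) \<Rightarrow> 'a \<Rightarrow> real" where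
  "incr k f = (\<lambda>x. f x - T k f x)"

lemma incr_Lp2: "0 \<le> k \<Longrightarrow> f \<in> Lp M 2 \<Longrightarrow> incr k f \<in> Lp M 2"
  unfolding incr_def by (intro Lp2_diff T_Lp2)

lemma corr_0:
  assumes "f \<in> Lp M 2"
  shows "corr f 0 = L2_inner M f f"
  unfolding corr_def using assms T_0[OF assms] T_measurable[of 0 f]
  by (intro L2_inner_cong_AE) (auto dest: Lp_measurable)

lemma corr_T:
  assumes "0 \<le> s" "0 \<le> t" "f \<in> Lp M 2"
  shows "corr (T t f) s = corr f (s + 2 * t)"
proof -
  have "corr (T t f) s = L2_inner M (T (s + t) (T t f)) f"
    unfolding corr_def using assms by (intro inner_T_T T_Lp2)
  also have "\<dots> = L2_inner M (T (s + t + t) f) f"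
    using T_add[of "s + t" t f] assms
    by (intro L2_inner_cong_AE) (auto intro!: T_measurable T_Lp2 Lp_measurable)
  finally show ?thesis by (simp add: corr_def algebra_simps)
qed

lemma corr_eq_square:
  assumes "0 \<le> s" "f \<in> Lp M 2"
  shows "corr f (2 * s) = L2_inner M (T s f) (T s f)"
  using inner_T_T[of s s f f] assms by (simp add: corr_def)

lemma corr_nonneg:
  assumes "0 \<le> s" "f \<in> Lp M 2"
  shows "0 \<le> corr f s"
  using corr_eq_square[of "s/2" f] assms by simp

text \<open>Replacing f by T (s/2) f moves the base point to 0, where the claim is Cauchy-Schwarz
  together with contractivity.\<close>

lemma corr_decreasing:
  assumes "0 \<le> s" "0 \<le> k" "f \<in> Lp M 2"
  shows "corr f (s + k) \<le> corr f s"
proof -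
  let ?v = "T (s/2) f"
  have v: "?v \<in> Lp M 2" using assms by (intro T_Lp2) auto
  have "corr f (s + k) = corr ?v k"
    using corr_T[of k "s/2" f] assms by (simp add: add.commute)
  also have "\<dots> \<le> Lp_norm M 2 (T k ?v) * Lp_norm M 2 ?v"
    unfolding corr_def using L2_inner_Cauchy_Schwarz[OF T_Lp2[OF assms(2) v] v] by linarith
  also have "\<dots> \<le> Lp_norm M 2 ?v * Lp_norm M 2 ?v"
    using T_inner_contraction[OF assms(2) v] by (intro mult_right_mono) (auto simp: Lp_norm_2)
  also have "\<dots> = corr ?v 0" using corr_0[OF v] by (simp add: Lp_norm_2)
  also have "\<dots> = corr f s" using corr_T[of 0 "s/2" f] assms by simp
  finally show ?thesis .
qed

text \<open>A second difference of a correlation function is again a correlation function. Hence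
  nonnegativity and monotonicity, once known for all f, pass to higher differences.\<close>

lemma corr_incr:
  assumes "0 \<le> s" "0 \<le> k" "f \<in> Lp M 2"
  shows "corr (incr k f) s = corr f s - 2 * corr f (s + k) + corr f (s + 2 * k)"
proof -
  let ?w = "incr k f"
  have w: "?w \<in> Lp M 2" and Tk: "T k f \<in> Lp M 2" and Ts: "T s f \<in> Lp M 2"
    and Tsk: "T (s + k) f \<in> Lp M 2"
    using assms by (auto intro: incr_Lp2 T_Lp2)
  have "AE x in M. T s ?w x = T s f x - T (s + k) f x"
    using T_diff[OF \<open>0 \<le> s\<close> \<open>f \<in> Lp M 2\<close> Tk] T_add[OF assms]
    by eventually_elim (simp add: incr_def)
  then have "corr ?w s = L2_inner M (\<lambda>x. T s f x - T (s + k) f x) ?w"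
    unfolding corr_def using assms w Lp2_diff[OF Ts Tsk]
    by (intro L2_inner_cong_AE) (auto intro: T_measurable Lp_measurable)
  also have "\<dots> = L2_inner M (T s f) ?w - L2_inner M (T (s + k) f) ?w"
    by (rule L2_inner_diff(1)[OF Ts Tsk w])
  also have "L2_inner M (T s f) ?w = corr f s - corr f (s + k)"
    unfolding incr_def using L2_inner_diff(2)[OF \<open>f \<in> Lp M 2\<close> Tk Ts] inner_T_T[of s k f f] assms
    by (simp add: corr_def)
  also have "L2_inner M (T (s + k) f) ?w = corr f (s + k) - corr f (s + 2 * k)"
    unfolding incr_def using L2_inner_diff(2)[OF \<open>f \<in> Lp M 2\<close> Tk Tsk] inner_T_T[of "s + k" k f f] assms
    by (simp add: corr_def algebra_simps)
  finally show ?thesis by simp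
qed

text \<open>Second differences of \<open>corr f\<close> are nonnegative, so first differences decrease.\<close>

lemma corr_first_difference:
  fixes N :: nat
  assumes "0 \<le> s" "0 \<le> k" "f \<in> Lp M 2"
  shows "real N * (corr f (s + real N * k) - corr f (s + real N * k + k)) \<le> corr f s - corr f (s + real N * k)"
proof (induction N)
  case (Suc N)
  let ?s = "s + real N * k"
  have "0 \<le> corr (incr k f) ?s" using assms by (intro corr_nonneg incr_Lp2) auto
  then have "corr f (?s + k) - corr f (?s + k + k) \<le> corr f ?s - corr f (?s + k)"
    using corr_incr[of ?s k f] assms by (simp add: algebra_simps)
  then have "real (Suc N) * (corr f (?s + k) - corr f (?s + k + k))
      \<le> real (Suc N) * (corr f ?s - corr f (?s + k))"
    by (intro mult_left_mono) auto
  also have "\<dots> \<le> corr f s - corr f (?s + k)" using Suc.IH by (simp add: algebra_simps)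
  finally show ?case by (simp add: algebra_simps)
qed simp

text \<open>With x = exp (- k \<lambda>) this is N (1 - x) x^N \<le> 1, squared and integrated.
  Summation replaces the spectral measure: N decreasing second differences add up to at most one
  first difference, and N decreasing first differences to at most one value of
  \<open>corr f\<close>.\<close>

lemma corr_incr_decay:
  fixes N :: nat
  assumes "0 \<le> s" "0 \<le> k" "f \<in> Lp M 2"
  shows "(real N)\<^sup>2 * corr (incr k f) (s + 2 * real N * k) \<le> corr f s"
proof -
  let ?d = "\<lambda>s. corr f s - corr f (s + k)" and ?w = "incr k f"
  have w: "?w \<in> Lp M 2" using assms by (intro incr_Lp2)
  have dw: "?d r - ?d (r + k) = corr ?w r" if "0 \<le> r" for r
    using corr_incr[of r k f] that assms by (simp add: algebra_simps)
  have step: "real N * corr ?w (r + real N * k) \<le> ?d r" if r: "0 \<le> r" for r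
  proof -
    have ind: "real n * corr ?w (r + real n * k) \<le> ?d r - ?d (r + real n * k)" for n :: nat
    proof (induction n)
      case (Suc n)
      let ?r = "r + real n * k"
      have r0: "0 \<le> ?r" using r assms by simp
      have "corr ?w (?r + k) \<le> corr ?w ?r"
        using r0 assms w by (intro corr_decreasing)
      then have "real (Suc n) * corr ?w (?r + k) \<le> real (Suc n) * corr ?w ?r"
        by (intro mult_left_mono) auto
      also have "\<dots> \<le> ?d r - ?d (?r + k)" using Suc.IH dw[OF r0] by (simp add: algebra_simps)
      finally show ?case by (simp add: algebra_simps)
    qed simp
    have "0 \<le> ?d (r + real N * k)"
      using corr_decreasing[of "r + real N * k" k f] r assms by simp
    then show ?thesis using ind[of N] by linarith
  qed
  have "(real N)\<^sup>2 * corr ?w (s + 2 * real N * k) = real N * (real N * corr ?w (s + real N * k + real N * k))"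
    by (simp add: power2_eq_square algebra_simps)
  also have "\<dots> \<le> real N * ?d (s + real N * k)"
    using step[of "s + real N * k"] assms by (intro mult_left_mono) auto
  also have "\<dots> \<le> corr f s - corr f (s + real N * k)"
    using corr_first_difference[OF assms] by simp
  also have "\<dots> \<le> corr f s" using corr_nonneg[of "s + real N * k" f] assms by simp
  finally show ?thesis .
qed

text \<open>
  The analyticity estimate \<open>\<parallel>(I - T k)\<^sup>2 T t f\<parallel> = O(k\<^sup>2)\<close> makes the difference quotients along
  \<open>t / 2 ^ n\<close> converge geometrically; self-adjointness then puts their limit into the graph.
\<close>

lemma T_in_generator_domain:
  assumes selfadj: "adjoint_graph M (generator M T) = generator M T"
    and t: "0 < t" and f: "f \<in> Lp M 2"
  shows "\<exists>h. (T t f, h) \<in> generator M T"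
proof -
  define u where "u = T t f"
  have u: "u \<in> Lp M 2" using t f by (simp add: u_def T_Lp2)
  \<comment> \<open>Dyadic steps make consecutive difference quotients use k and 2 k, which is what
    produces a second increment.\<close>
  define r where "r = (\<lambda>n. t / 2 ^ n)"
  have r: "0 < r n" for n using t by (simp add: r_def)
  define g where "g = (\<lambda>k x. (u x - T k u x) / k)"
  have g: "g k \<in> Lp M 2" if "0 < k" for k
    using Lp2_scale[OF incr_Lp2[of k u], of "1/k"] that u by (simp add: g_def incr_def)
  have bound: "(\<integral>x. (g (r (Suc n)) x - g (r n) x)\<^sup>2 \<partial>M) \<le> L2_inner M f f / t\<^sup>2 * (1/4) ^ n" for n
  proof -
    define k where "k = r (Suc n)"
    define N :: nat where "N = 2 ^ n"
    have k: "0 < k" "r n = 2 * k" "4 * real N * k = 2 * t" "k = t / (2 * real N)"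
      using r[of "Suc n"] by (auto simp: k_def r_def N_def)
    let ?w = "incr k (incr k u)"
    have iu: "incr k u \<in> Lp M 2" and iif: "incr k f \<in> Lp M 2" and Tku: "T k u \<in> Lp M 2"
      using k u f by (auto intro: incr_Lp2 T_Lp2)
    \<comment> \<open>The two quotients combine to (u - 2 T k u + T (2 k) u) / (2 k), that is, (I -
      T k)^2 u / (2 k).\<close>
    have "AE x in M. g (r (Suc n)) x - g (r n) x = 1 / (2 * k) * ?w x"
      using T_diff[OF less_imp_le[OF k(1)] u Tku] T_add[OF less_imp_le[OF k(1)] less_imp_le[OF k(1)] u]
    proof eventually_elim
      case (elim x)
      have "T k (incr k u) x = T k u x - T (2 * k) u x"
        using elim k u Tku by (simp add: incr_def)
      then have W: "?w x = u x - 2 * T k u x + T (2 * k) u x"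
        by (simp add: incr_def)
      show ?case using k(1) unfolding W by (simp add: g_def k_def[symmetric] k(2) field_simps)
    qed
    then have "(\<integral>x. (g (r (Suc n)) x - g (r n) x)\<^sup>2 \<partial>M) = (\<integral>x. (1 / (2 * k) * ?w x)\<^sup>2 \<partial>M)"
      using borel_measurable_diff[OF Lp_measurable[OF g[OF r]] Lp_measurable[OF g[OF r]]]
        Lp_measurable[OF incr_Lp2[OF less_imp_le[OF k(1)] iu]]
      by (intro integral_cong_AE) (auto elim: eventually_mono)
    also have "\<dots> = (1 / (2 * k))\<^sup>2 * L2_inner M ?w ?w"
      by (simp add: L2_inner_def power_divide power_mult_distrib power2_eq_square)
    also have "L2_inner M ?w ?w = corr ?w 0" using incr_Lp2[OF _ iu] k by (simp add: corr_0)
    \<comment> \<open>T t commutes with increments and occurs in both factors of the inner product,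
      so it shifts the time by 2 t.\<close>
    also have "\<dots> = corr (incr k (incr k f)) (2 * t)"
    proof -
      have "corr (incr k u) s = corr (incr k f) (s + 2 * t)" if "0 \<le> s" for s
        using corr_incr[of s k u] corr_incr[of "s + 2 * t" k f] that k t u f
        by (simp add: corr_T u_def algebra_simps)
      then show ?thesis
        using corr_incr[of 0 k "incr k u"] corr_incr[of "2 * t" k "incr k f"] k t iu iif
        by (simp add: add.commute)
    qed
    also have "(1 / (2 * k))\<^sup>2 * corr (incr k (incr k f)) (2 * t) \<le> L2_inner M f f / t\<^sup>2 * (1/4) ^ n"
    proof -
      \<comment> \<open>The time 2 t is split into two portions of length t, one for each increment.
        Each gains 1 / N^2, while the prefactor (N / t)^2 costs N^2; what remains is 1 / N^2 =
        4^-n.\<close>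
      have Nk: "2 * real N * k = t" using k(3) by linarith
      have "(real N)\<^sup>2 * corr (incr k (incr k f)) (t + 2 * real N * k) \<le> corr (incr k f) t"
        using k(1) t iif by (intro corr_incr_decay) auto
      then have "(real N)\<^sup>2 * ((real N)\<^sup>2 * corr (incr k (incr k f)) (2 * t))
          \<le> (real N)\<^sup>2 * corr (incr k f) (0 + 2 * real N * k)"
        unfolding Nk by (intro mult_left_mono) auto
      also have "\<dots> \<le> corr f 0"
        using k(1) f by (intro corr_incr_decay) auto
      also have "\<dots> = L2_inner M f f" by (rule corr_0[OF f])
      finally have "(real N)\<^sup>2 * ((real N)\<^sup>2 * corr (incr k (incr k f)) (2 * t)) \<le> L2_inner M f f" .
      then have "corr (incr k (incr k f)) (2 * t) \<le> L2_inner M f f / ((real N)\<^sup>2 * (real N)\<^sup>2)"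
        by (simp add: field_simps N_def)
      moreover have "1 / (2 * k) = real N / t" by (simp add: k(4))
      ultimately have "(1 / (2 * k))\<^sup>2 * corr (incr k (incr k f)) (2 * t)
          \<le> (real N / t)\<^sup>2 * (L2_inner M f f / ((real N)\<^sup>2 * (real N)\<^sup>2))"
        by (simp only:) (intro mult_left_mono, auto)
      also have "\<dots> = L2_inner M f f / t\<^sup>2 * (1 / (real N)\<^sup>2)"
      proof -
        have "0 < real N" by (simp add: N_def)
        then show ?thesis using t by (simp add: field_simps power2_eq_square)
      qed
      also have "1 / (real N)\<^sup>2 = (1/4) ^ n"
      proof -
        have "(real N)\<^sup>2 = (2\<^sup>2) ^ n"
          unfolding N_def of_nat_power of_nat_numeral power_mult[symmetric] by (simp only: mult.commute)
        then show ?thesis by (simp add: power_divide)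
      qed
      finally show ?thesis .
    qed
    finally show ?thesis .
  qed
  from L2_geometric_weak_limit[OF g[OF r] bound]
  obtain h where h: "h \<in> Lp M 2"
    and lim: "\<And>v. v \<in> Lp M 2 \<Longrightarrow> (\<lambda>n. L2_inner M (g (r n)) v) \<longlonglongrightarrow> L2_inner M h v"
    by blast
  have r0: "filterlim r (at_right 0) sequentially"
  proof -
    have "(\<lambda>n. t * (1/2) ^ n) \<longlonglongrightarrow> t * 0" by (intro tendsto_mult_left LIMSEQ_realpow_zero) auto
    then have "r \<longlonglongrightarrow> 0" by (simp add: r_def power_divide)
    then show ?thesis using r by (intro filterlim_at_withinI) (auto simp: eventually_at_filter)
  qed
  \<comment> \<open>Symmetry moves the difference quotient from u to v, where it converges in norm
    because v is in the domain; the two limits are then compared.\<close>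
  have "(u, h) \<in> adjoint_graph M (generator M T)"
    unfolding adjoint_graph_def
  proof (clarsimp simp: u h)
    fix v k assume vk: "(v, k) \<in> generator M T"
    then have v: "v \<in> Lp M 2" and kk: "k \<in> Lp M 2"
      and conv: "((\<lambda>t. Lp_norm M 2 (\<lambda>x. (v x - T t v x) / t - k x)) \<longlongrightarrow> 0) (at_right 0)"
      by (auto simp: generator_def)
    let ?F = "\<lambda>n x. (v x - T (r n) v x) / r n"
    have F: "?F n \<in> Lp M 2" for n
      using Lp2_scale[OF incr_Lp2[of "r n" v], of "1/r n"] r[of n] v by (simp add: incr_def)
    have "(\<lambda>n. L2_inner M (?F n) u) \<longlonglongrightarrow> L2_inner M k u"
      using filterlim_compose[OF conv r0] by (intro L2_inner_tendsto F kk u)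
    moreover have "L2_inner M (?F n) u = L2_inner M (g (r n)) v" for n
    proof -
      have *: "L2_inner M (\<lambda>x. (a x - T (r n) a x) / r n) b
          = (L2_inner M a b - L2_inner M (T (r n) a) b) / r n"
        if a: "a \<in> Lp M 2" and b: "b \<in> Lp M 2" for a b
        using L2_inner_lincomb[OF a T_Lp2[OF _ a] b, of "r n" "1 / r n" "- 1 / r n"] r[of n]
        by (simp add: diff_divide_distrib)
      show ?thesis unfolding g_def *[OF u v] *[OF v u]
        using T_symmetric[of "r n" v u] r[of n] u v by (simp add: L2_inner_commute)
    qed
    ultimately have "(\<lambda>n. L2_inner M (g (r n)) v) \<longlonglongrightarrow> L2_inner M k u" by simp
    then show "L2_inner M k u = L2_inner M v h"
      using LIMSEQ_unique[OF _ lim[OF v]] by (simp add: L2_inner_commute)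
  qed
  then show ?thesis using selfadj by (auto simp: u_def)
qed

end

section \<open>The quadratic form and the Nash inequality\<close>

text \<open>By symmetry of S, (S u, S u) = (S S u, u). The value chosen by \<open>SOME\<close> may
  differ from the k through which \<open>S O S\<close> factors, but the difference is orthogonal to
  the dense domain of S and hence null.\<close>

lemma quad_form_eq:
  assumes sqrt: "is_sqrt_of M S A" and uh: "(u, h) \<in> A"
  shows "u \<in> Domain S" and "quad_form M S u = L2_inner M h u"
proof -
  have adj: "adjoint_graph M S = S" and dense: "densely_defined M S" and "S O S = A"
    using sqrt by (auto simp: is_sqrt_of_def nonneg_selfadjoint_def)
  have L2: "a \<in> Lp M 2 \<and> b \<in> Lp M 2" if "(a, b) \<in> S" for a b
    using that adj by (subst (asm) adj[symmetric]) (auto simp: adjoint_graph_def)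
  have sym: "L2_inner M b c = L2_inner M a d" if ab: "(a, b) \<in> S" and cd: "(c, d) \<in> S" for a b c d
  proof -
    have "(c, d) \<in> adjoint_graph M S" using cd adj by simp
    then show ?thesis using ab by (auto simp: adjoint_graph_def)
  qed
  obtain k where uk: "(u, k) \<in> S" and kh: "(k, h) \<in> S"
    using uh \<open>S O S = A\<close> by blast
  then show "u \<in> Domain S" by blast
  define k' where "k' = (SOME h. (u, h) \<in> S)"
  have uk': "(u, k') \<in> S" unfolding k'_def by (rule someI[of "\<lambda>h. (u, h) \<in> S", OF uk])
  define w where "w = (\<lambda>x. k x - k' x)"
  have kL: "k \<in> Lp M 2" and k'L: "k' \<in> Lp M 2" using L2[OF uk] L2[OF uk'] by auto
  have w: "w \<in> Lp M 2" unfolding w_def by (rule Lp2_diff[OF kL k'L])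
  have "L2_inner M w w = 0"
  proof (rule ccontr)
    assume "L2_inner M w w \<noteq> 0"
    then have pos: "0 < Lp_norm M 2 w" by (simp add: Lp_norm_2 less_le)
    then obtain a b where ab: "(a, b) \<in> S" and close: "Lp_norm M 2 (\<lambda>x. w x - a x) < Lp_norm M 2 w"
      using dense w unfolding densely_defined_def by (meson DomainE)
    have a: "a \<in> Lp M 2" using L2[OF ab] by simp
    have "L2_inner M a w = 0"
      unfolding w_def using L2_inner_diff(2)[OF kL k'L a] sym[OF ab uk] sym[OF ab uk'] by simp
    then have "L2_inner M w w = L2_inner M (\<lambda>x. w x - a x) w"
      using L2_inner_diff(1)[OF w a w] by simp
    also have "\<dots> \<le> Lp_norm M 2 (\<lambda>x. w x - a x) * Lp_norm M 2 w"
      using L2_inner_Cauchy_Schwarz[OF Lp2_diff[OF w a] w] by linarith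
    also have "\<dots> < Lp_norm M 2 w * Lp_norm M 2 w"
      using close pos by (intro mult_strict_right_mono)
    finally show False by (simp add: Lp_norm_2)
  qed
  then have "AE x in M. k x = k' x"
    using L2_inner_self_eq_0[OF w] by (auto simp: w_def elim: eventually_mono)
  then have "L2_inner M k' k' = L2_inner M k k"
    unfolding L2_inner_def using Lp_measurable[OF kL] Lp_measurable[OF k'L]
    by (intro integral_cong_AE) (auto elim: eventually_mono)
  then show "quad_form M S u = L2_inner M h u"
    using sym[OF kh uk] by (simp add: quad_form_def k'_def[symmetric])
qed

text \<open>The number (h, T b f) is minus the slope of \<open>corr f\<close> at 2 b. By convexity,
  the chord over [2 a, 2 b] descends at least as steeply.\<close>

lemma (in sym_submarkovian) dissipation:
  assumes "0 \<le> a" "a < b" and f: "f \<in> Lp M 2" and gen: "(T b f, h) \<in> generator M T"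
  shows "2 * (b - a) * L2_inner M h (T b f)
    \<le> L2_inner M (T a f) (T a f) - L2_inner M (T b f) (T b f)"
proof -
  let ?u = "T b f"
  \<comment> \<open>n + 1 steps of this size lead exactly from 2 a to 2 b; the times are doubled
    because \<open>corr f (2 * s)\<close> is the squared norm at time s.\<close>
  define r where "r = (\<lambda>n. 2 * (b - a) / real (Suc n))"
  have r: "0 < r n" for n using assms by (simp add: r_def)
  have u: "?u \<in> Lp M 2" and h: "h \<in> Lp M 2"
    and conv: "((\<lambda>t. Lp_norm M 2 (\<lambda>x. (?u x - T t ?u x) / t - h x)) \<longlongrightarrow> 0) (at_right 0)"
    using gen by (auto simp: generator_def)
  let ?F = "\<lambda>n x. (?u x - T (r n) ?u x) / r n"
  have F: "?F n \<in> Lp M 2" for n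
    using Lp2_scale[OF incr_Lp2[of "r n" ?u], of "1/r n"] r[of n] u by (simp add: incr_def)
  have r0: "filterlim r (at_right 0) sequentially"
  proof -
    have "r \<longlonglongrightarrow> 0" unfolding r_def
      by (intro real_tendsto_divide_at_top[OF tendsto_const] filterlim_compose[OF filterlim_real_sequentially]
          filterlim_Suc)
    then show ?thesis using r by (intro filterlim_at_withinI) (auto simp: eventually_at_filter)
  qed
  have "(\<lambda>n. L2_inner M (?F n) ?u) \<longlonglongrightarrow> L2_inner M h ?u"
    using filterlim_compose[OF conv r0] by (intro L2_inner_tendsto F h u)
  then have "(\<lambda>n. 2 * (b - a) * L2_inner M (?F n) ?u) \<longlonglongrightarrow> 2 * (b - a) * L2_inner M h ?u"
    by (intro tendsto_mult_left)
  moreover have "2 * (b - a) * L2_inner M (?F n) ?u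
    \<le> L2_inner M (T a f) (T a f) - L2_inner M (T b f) (T b f)" for n
  proof -
    have rn: "real (Suc n) * r n = 2 * (b - a)" by (simp add: r_def)
    have "L2_inner M (?F n) ?u = (L2_inner M ?u ?u - L2_inner M (T (r n) ?u) ?u) / r n"
      using L2_inner_lincomb[OF u T_Lp2[OF _ u] u, of "r n" "1 / r n" "- 1 / r n"] r[of n]
      by (simp add: diff_divide_distrib)
    also have "\<dots> = (corr f (2 * b) - corr f (2 * b + r n)) / r n"
      using corr_eq_square[of b f] corr_T[of "r n" b f] r[of n] assms
      by (simp add: corr_def add.commute)
    finally have "2 * (b - a) * L2_inner M (?F n) ?u
        = real (Suc n) * (corr f (2 * b) - corr f (2 * b + r n))"
      unfolding rn[symmetric] using r[of n] by simp
    also have "\<dots> \<le> corr f (2 * a) - corr f (2 * b)"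
    proof -
      have "2 * a + real (Suc n) * r n = 2 * b" using rn by simp
      then show ?thesis
        using corr_first_difference[of "2 * a" "r n" f "Suc n"] r[of n] assms(1) f by simp
    qed
    also have "\<dots> = L2_inner M (T a f) (T a f) - L2_inner M ?u ?u"
      using corr_eq_square[of a f] corr_eq_square[of b f] assms by simp
    finally show ?thesis .
  qed
  ultimately show ?thesis by (intro LIMSEQ_le_const2) auto
qed

lemma Lp1_Lp_inf_Lp2:
  assumes "f \<in> Lp M 1" "f \<in> Lp M \<infinity>"
  shows "f \<in> Lp M 2"
proof -
  obtain C where C: "AE x in M. \<bar>f x\<bar> \<le> C" using assms by (auto simp: Lp_inf_iff)
  have "integrable M (\<lambda>x. (f x)\<^sup>2)"
  proof (rule Bochner_Integration.integrable_bound)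
    show "integrable M (\<lambda>x. C * f x)" using assms by (simp add: Lp1_iff)
    show "AE x in M. norm ((f x)\<^sup>2) \<le> norm (C * f x)"
      using C
    proof eventually_elim
      case (elim x)
      then have "\<bar>f x\<bar> * \<bar>f x\<bar> \<le> \<bar>C\<bar> * \<bar>f x\<bar>" by (intro mult_right_mono) auto
      then show ?case by (simp add: power2_eq_square abs_mult)
    qed
  qed (use Lp_measurable[OF assms(1)] in auto)
  then show ?thesis using assms by (simp add: Lp2_iff Lp_measurable)
qed

text \<open>
  Jensen's inequality for the probability measure \<open>u\<^sup>2 / \<parallel>u\<parallel>\<^sub>2\<^sup>2\<close>, in the form
  \<open>ln (u / c) \<ge> 1 - c / u\<close> with the optimal \<open>c = \<parallel>u\<parallel>\<^sub>2\<^sup>2 / \<parallel>u\<parallel>\<^sub>1\<close>.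
\<close>

lemma entropy_lower_bound:
  assumes u1: "u \<in> Lp M 1" and uinf: "u \<in> Lp M \<infinity>" and u0: "AE x in M. 0 \<le> u x"
    and N: "0 < L2_inner M u u" and norm1: "Lp_norm M 1 u \<le> 1"
  shows "L2_inner M u u * ln (L2_inner M u u) / 2
    \<le> (\<integral>x. (u x)\<^sup>2 * ln (u x / Lp_norm M 2 u) \<partial>M)"
proof -
  define N n m c where "N = L2_inner M u u" and "n = Lp_norm M 2 u"
    and "m = (\<integral>x. u x \<partial>M)" and "c = N / m"
  have u2: "u \<in> Lp M 2" by (rule Lp1_Lp_inf_Lp2[OF u1 uinf])
  have [measurable]: "u \<in> borel_measurable M" using u1 by (rule Lp_measurable)
  have int1: "integrable M u" and int2: "integrable M (\<lambda>x. (u x)\<^sup>2)"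
    using u1 u2 by (auto simp: Lp1_iff Lp2_iff)
  have Nint: "N = (\<integral>x. (u x)\<^sup>2 \<partial>M)" by (simp add: N_def L2_inner_def power2_eq_square)
  have N0: "0 < N" using N by (simp add: N_def)
  have n: "n = sqrt N" "0 < n" using N0 by (simp_all add: n_def N_def Lp_norm_2)
  have "m = (\<integral>x. \<bar>u x\<bar> \<partial>M)" unfolding m_def
    using u0 by (intro integral_cong_AE) (auto elim: eventually_mono)
  then have m1: "m \<le> 1" using norm1 by (simp add: Lp_norm_1)
  have m0: "0 < m"
  proof (rule ccontr)
    assume "\<not> 0 < m"
    moreover have "0 \<le> m" unfolding m_def using u0 by (rule integral_nonneg_AE)
    ultimately have "AE x in M. u x = 0"
      using integral_nonneg_eq_0_iff_AE[OF int1 u0] by (simp add: m_def)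
    then have "N = (\<integral>x. 0 \<partial>M)" unfolding Nint
      by (intro integral_cong_AE) (auto elim: eventually_mono)
    then show False using N0 by simp
  qed
  have c0: "0 < c" using N0 m0 by (simp add: c_def)
  obtain C where C: "AE x in M. \<bar>u x\<bar> \<le> C" using uinf by (auto simp: Lp_inf_iff)
  \<comment> \<open>A nonintegrable function would have integral 0 by default, so integrability must
    precede the comparison. It follows from \<bar>ln y\<bar> \<le> y + 1 / y, whose pole the factor
    u^2 absorbs.\<close>
  have int: "integrable M (\<lambda>x. (u x)\<^sup>2 * ln (u x / n))"
  proof (rule Bochner_Integration.integrable_bound)
    show "integrable M (\<lambda>x. (C\<^sup>2 / n + n) * u x)" using int1 by simp
    show "AE x in M. norm ((u x)\<^sup>2 * ln (u x / n)) \<le> norm ((C\<^sup>2 / n + n) * u x)"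
      using C u0
    proof eventually_elim
      case (elim x)
      show ?case
      proof (cases "u x = 0")
        case False
        then have ux: "0 < u x" using elim by simp
        have "ln (u x / n) \<le> u x / n" using ln_le_minus_one[of "u x / n"] ux n(2) by simp
        moreover have "- ln (u x / n) \<le> n / u x"
          using ln_le_minus_one[of "n / u x"] ux n(2) by (simp add: ln_div)
        moreover have "0 < u x / n" "0 < n / u x" using ux n(2) by auto
        ultimately have "\<bar>ln (u x / n)\<bar> \<le> u x / n + n / u x" by linarith
        then have "(u x)\<^sup>2 * \<bar>ln (u x / n)\<bar> \<le> (u x)\<^sup>2 * (u x / n + n / u x)"
          by (intro mult_left_mono) auto
        also have "\<dots> = ((u x)\<^sup>2 / n + n) * u x"
          using ux n(2) by (simp add: field_simps power2_eq_square)
        also have "\<dots> \<le> (C\<^sup>2 / n + n) * u x"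
          using elim ux n(2) by (intro mult_right_mono add_right_mono divide_right_mono power_mono) auto
        finally show ?thesis using ux n(2) by (simp add: abs_mult)
      qed simp
    qed
  qed simp
  \<comment> \<open>Here ln (c / n) = (ln N) / 2 - ln m, and the normalisation m \<le> 1 disposes of
    the last term.\<close>
  have "N * ln N / 2 \<le> N * ln (c / n)"
  proof -
    have "ln (c / n) = ln N - ln m - ln N / 2"
    proof -
      have "ln (c / n) = ln c - ln n" using c0 n(2) by (simp add: ln_div)
      moreover have "ln c = ln N - ln m" using N0 m0 by (simp add: c_def ln_div)
      moreover have "ln n = ln N / 2" using N0 by (simp add: n(1) ln_sqrt)
      ultimately show ?thesis by simp
    qed
    moreover have "ln m \<le> 0" using m0 m1 by simp
    ultimately have "ln N / 2 \<le> ln (c / n)" by linarith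
    then show ?thesis using N0 mult_left_mono[of "ln N / 2" "ln (c/n)" N] by simp
  qed
  \<comment> \<open>Since c * m = N, the two extra terms cancel after integration.\<close>
  also have "\<dots> = (\<integral>x. (1 + ln (c / n)) * (u x)\<^sup>2 - c * u x \<partial>M)"
    using int1 int2 m0 by (simp add: Nint[symmetric] m_def[symmetric] c_def algebra_simps)
  also have "\<dots> \<le> (\<integral>x. (u x)\<^sup>2 * ln (u x / n) \<partial>M)"
  proof (rule integral_mono_AE)
    show "AE x in M. (1 + ln (c / n)) * (u x)\<^sup>2 - c * u x \<le> (u x)\<^sup>2 * ln (u x / n)"
      using u0
    proof eventually_elim
      case (elim x)
      show ?case
      proof (cases "u x = 0")
        case False
        then have ux: "0 < u x" using elim by simp
        have "1 - c / u x \<le> ln (u x / c)"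
          using ln_le_minus_one[of "c / u x"] ux c0 by (simp add: ln_div)
        then have "1 - c / u x + ln (c / n) \<le> ln (u x / n)"
          using ux c0 n(2) by (simp add: ln_div)
        then have "(u x)\<^sup>2 * (1 - c / u x + ln (c / n)) \<le> (u x)\<^sup>2 * ln (u x / n)"
          by (intro mult_left_mono) auto
        moreover have "(u x)\<^sup>2 * (1 - c / u x + ln (c / n)) = (1 + ln (c / n)) * (u x)\<^sup>2 - c * u x"
          using ux by (simp add: field_simps power2_eq_square)
        ultimately show ?thesis by simp
      qed simp
    qed
  qed (use int int1 int2 in auto)
  finally show ?thesis by (simp add: N_def n_def)
qed

text \<open>The logarithmic Sobolev inequality with parameter 1 / t, multiplied by t / N, bounds one
  affine function in the supremum defining B. This is where \<beta> (1 / t) comes from.\<close>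

lemma Nash_inequality:
  assumes "u \<in> Lp M 1" "u \<in> Lp M \<infinity>" "AE x in M. 0 \<le> u x"
    and N: "0 < L2_inner M u u" and "Lp_norm M 1 u \<le> 1"
    and log_sobolev: "\<And>t. 0 < t \<Longrightarrow> (\<integral>x. (u x)\<^sup>2 * ln (u x / Lp_norm M 2 u) \<partial>M)
      \<le> t * Q + \<beta> t * (Lp_norm M 2 u)\<^sup>2"
  shows "B_fun \<beta> (ln (L2_inner M u u)) \<le> ereal (Q / L2_inner M u u)"
  unfolding B_fun_def
proof (rule SUP_least)
  fix t :: real assume "t \<in> {0<..}"
  then have t: "0 < t" by simp
  let ?N = "L2_inner M u u"
  have "?N * ln ?N / 2 \<le> 1 / t * Q + \<beta> (1 / t) * ?N"
    using entropy_lower_bound[OF assms(1-5)] log_sobolev[of "1 / t"] t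
    unfolding Lp_norm_2 real_sqrt_pow2[OF L2_inner_self_nonneg] by (meson order_trans zero_less_divide_1_iff)
  then have "t * (?N * ln ?N / 2) \<le> t * (1 / t * Q + \<beta> (1 / t) * ?N)"
    using t by (intro mult_left_mono) auto
  then have "?N * (t * ln ?N / 2 - t * \<beta> (1 / t)) \<le> Q" using t by (simp add: algebra_simps)
  then show "ereal (t * ln ?N / 2 - t * \<beta> (1 / t)) \<le> ereal (Q / ?N)"
    using N by (simp add: pos_le_divide_eq mult.commute)
qed

section \<open>The functions \<open>B\<close> and \<open>q\<close>\<close>

lemma B_fun_mono: "y \<le> z \<Longrightarrow> B_fun \<beta> y \<le> B_fun \<beta> z"
  unfolding B_fun_def
  by (intro SUP_mono) (auto intro!: bexI divide_right_mono mult_left_mono)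

text \<open>The supremum runs over an uncountable family, so measurability comes from topology:
  strict superlevel sets are unions of open sets.\<close>

lemma borel_measurable_B_fun [measurable]: "B_fun \<beta> \<in> borel_measurable borel"
proof (rule borel_measurableI_greater)
  fix c
  have "{y \<in> space borel. c < B_fun \<beta> y} = (\<Union>t\<in>{0<..}. {y. c < ereal (t * y / 2 - t * \<beta> (1 / t))})"
    by (auto simp: B_fun_def less_SUP_iff)
  also have "open \<dots>"
    by (intro open_UN ballI open_Collect_less continuous_intros) auto
  finally show "{y \<in> space borel. c < B_fun \<beta> y} \<in> sets borel" by simp
qed

lemma q_fun_antimono: "s \<le> s' \<Longrightarrow> q_fun \<beta> s' \<le> q_fun \<beta> s"
  unfolding q_fun_def by (intro nn_integral_mono) (auto split: split_indicator)

text \<open>As 1 / B is nonincreasing, a rectangle of height 1 / b fits under it over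
  [s, s'].\<close>

lemma q_fun_step:
  assumes "s \<le> s'" and B: "B_fun \<beta> s' \<le> ereal b" and b: "0 < b"
  shows "ennreal ((s' - s) / b) + q_fun \<beta> s' \<le> q_fun \<beta> s"
proof -
  let ?F = "\<lambda>y. inverse (e2ennreal (B_fun \<beta> y))"
  have F: "ennreal (1 / b) \<le> ?F y" if "y \<le> s'" for y
  proof -
    have "e2ennreal (B_fun \<beta> y) \<le> e2ennreal (ereal b)"
      using B_fun_mono[OF that, of \<beta>] B by (intro e2ennreal_mono) (rule order_trans)
    then have "e2ennreal (B_fun \<beta> y) \<le> ennreal b" by (simp add: e2ennreal_ereal)
    then obtain r where r: "e2ennreal (B_fun \<beta> y) = ennreal r" "0 \<le> r" "r \<le> b"
      using b by (cases "e2ennreal (B_fun \<beta> y)") (auto simp: top_unique)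
    \<comment> \<open>r = 0 covers all values B y \<le> 0, which \<open>e2ennreal\<close> truncates;
      the reciprocal is then \<infinity>.\<close>
    show ?thesis
    proof (cases "r = 0")
      case False
      then show ?thesis
        using r b by (auto simp: inverse_ennreal inverse_eq_divide intro!: ennreal_leI divide_left_mono)
    qed (simp add: r)
  qed
  have "ennreal ((s' - s) / b) = (\<integral>\<^sup>+y. ennreal (1 / b) * indicator {s..<s'} y \<partial>lborel)"
    using assms by (simp add: nn_integral_cmult_indicator ennreal_mult'[symmetric])
  then have "ennreal ((s' - s) / b) + q_fun \<beta> s'
      = (\<integral>\<^sup>+y. ennreal (1 / b) * indicator {s..<s'} y + ?F y * indicator {s'..} y \<partial>lborel)"
    unfolding q_fun_def by (subst nn_integral_add) auto
  also have "\<dots> \<le> (\<integral>\<^sup>+y. ?F y * indicator {s..} y \<partial>lborel)"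
    using assms(1) F by (intro nn_integral_mono) (auto split: split_indicator)
  finally show ?thesis by (simp add: q_fun_def)
qed

lemma q_fun_finite_imp_B_fun_pos:
  assumes q: "q_fun \<beta> s < \<infinity>" and y: "s < y"
  shows "0 < B_fun \<beta> y"
proof (rule ccontr)
  assume "\<not> 0 < B_fun \<beta> y"
  then have B: "B_fun \<beta> y \<le> 0" by simp
  obtain z where z: "q_fun \<beta> s = ennreal z" "0 \<le> z" using q by (cases "q_fun \<beta> s") auto
  \<comment> \<open>Every positive b bounds B y, and this one gives a rectangle of area z + 1, too
    large for q s = z.\<close>
  define b where "b = (y - s) / (z + 1)"
  have b: "0 < b" using y z by (simp add: b_def)
  have "ennreal ((y - s) / b) \<le> q_fun \<beta> s"
    using q_fun_step[of s y \<beta> b] y b B order_trans[OF B, of "ereal b"]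
    by (auto intro: order_trans[OF add_increasing2[OF _ order_refl]])
  moreover have "(y - s) / b = z + 1" using y z by (simp add: b_def)
  ultimately show False using z by simp
qed

text \<open>
  Discrete form of: if \<open>L = ln \<phi>\<close> satisfies \<open>L' \<le> - 2 B L\<close>, then \<open>q (L \<tau>) \<ge> 2 \<tau>\<close>. Riemann sums of
  \<open>1 / B\<close> over the points \<open>L t\<^sub>j\<close> produce the ratios \<open>B (L t\<^sub>j\<^sub>+\<^sub>1) / B (L t\<^sub>j)\<close>, which are bounded below by
  \<open>1\<close> plus a telescoping difference of logarithms; no continuity of \<open>B\<close> is needed.
\<close>

lemma q_fun_decay:
  assumes inv: "is_inverse_fun (q_fun \<beta>) m" and \<tau>: "0 < \<tau>"
    and pos: "\<And>t. 0 \<le> t \<Longrightarrow> t \<le> \<tau> \<Longrightarrow> 0 < \<phi> t"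
    and anti: "\<And>a b. 0 \<le> a \<Longrightarrow> a \<le> b \<Longrightarrow> b \<le> \<tau> \<Longrightarrow> \<phi> b \<le> \<phi> a"
    and rate: "\<And>a b. 0 \<le> a \<Longrightarrow> a < b \<Longrightarrow> b \<le> \<tau> \<Longrightarrow>
      B_fun \<beta> (ln (\<phi> b)) \<le> ereal ((\<phi> a - \<phi> b) / (2 * (b - a)) / \<phi> b)"
  shows "ln (\<phi> \<tau>) \<le> m (2 * \<tau>)"
proof (rule ccontr)
  assume "\<not> ?thesis"
  then have less: "m (2 * \<tau>) < ln (\<phi> \<tau>)" by simp
  define L where "L = (\<lambda>t. ln (\<phi> t))"
  define B where "B = (\<lambda>t. real_of_ereal (B_fun \<beta> (L t)))"
  have qm: "q_fun \<beta> (m (2 * \<tau>)) = ennreal (2 * \<tau>)"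
    using inv \<tau> by (simp add: is_inverse_fun_def)
  have L_anti: "L b \<le> L a" if "0 \<le> a" "a \<le> b" "b \<le> \<tau>" for a b
    unfolding L_def using anti[OF that] pos[of a] pos[of b] that by simp
  \<comment> \<open>Finiteness comes from \<open>rate\<close> at the right end of an interval, hence
    only for t > 0; this is why the estimate below starts at some a > 0. Positivity holds because L
    t exceeds a point where q is finite.\<close>
  have B: "B_fun \<beta> (L t) = ereal (B t)" "0 < B t" if t: "0 < t" "t \<le> \<tau>" for t
  proof -
    have "m (2 * \<tau>) < L t" using L_anti[of t \<tau>] less t by (simp add: L_def)
    then have "0 < B_fun \<beta> (L t)" using q_fun_finite_imp_B_fun_pos[of \<beta> "m (2 * \<tau>)"] qm by simp
    moreover have "B_fun \<beta> (L t) < \<infinity>"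
      using rate[of 0 t] t by (auto simp: L_def intro: le_less_trans)
    ultimately show "B_fun \<beta> (L t) = ereal (B t)" "0 < B t"
      by (cases "B_fun \<beta> (L t)"; simp add: B_def)+
  qed
  have B_anti: "B b \<le> B a" if "0 < a" "a \<le> b" "b \<le> \<tau>" for a b
    using B_fun_mono[OF L_anti[of a b], of \<beta>] B(1)[of a] B(1)[of b] that by simp
  \<comment> \<open>With x the product 2 (b - a) B b, \<open>rate\<close> says (1 + x) \<phi> b
    \<le> \<phi> a, and ln (1 + x) \<ge> x / (1 + x).\<close>
  have drop: "2 * (b - a) * B b / (1 + 2 * (b - a) * B b) \<le> L a - L b"
    if ab: "0 < a" "a < b" "b \<le> \<tau>" for a b
  proof -
    define x where "x = 2 * (b - a) * B b"
    have x: "0 < x" using ab B(2)[of b] by (simp add: x_def)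
    have pa: "0 < \<phi> a" and pb: "0 < \<phi> b" using pos ab by auto
    have "B b \<le> (\<phi> a - \<phi> b) / (2 * (b - a)) / \<phi> b"
      using rate[of a b] B(1)[of b] ab by (simp add: L_def)
    then have "(1 + x) * \<phi> b \<le> \<phi> a" using ab pb by (simp add: x_def field_simps)
    then have "ln ((1 + x) * \<phi> b) \<le> ln (\<phi> a)" using pa pb x by simp
    then have "ln (1 + x) \<le> L a - L b" using pb x by (simp add: L_def ln_mult)
    moreover have "x / (1 + x) \<le> ln (1 + x)"
      using ln_le_minus_one[of "1 / (1 + x)"] x by (simp add: ln_div field_simps)
    ultimately show ?thesis by (simp add: x_def)
  qed
  \<comment> \<open>Under the contrary assumption monotonicity gives q (L \<tau>) \<le> 2 \<tau>;
    the rest establishes the opposite inequality.\<close>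
  obtain z where z: "q_fun \<beta> (L \<tau>) = ennreal z" "0 \<le> z" "z \<le> 2 * \<tau>"
    using q_fun_antimono[of "m (2 * \<tau>)" "L \<tau>" \<beta>] less qm \<tau>
    by (cases "q_fun \<beta> (L \<tau>)") (auto simp: L_def top_unique)
  have za: "2 * (\<tau> - a) \<le> z" if a: "0 < a" "a < \<tau>" for a
  proof -
    have approx: "2 * (\<tau> - a) * (1 + (ln (B \<tau>) - ln (B a)) / real (Suc n))
        / (1 + 2 * (\<tau> - a) * B a / real (Suc n)) \<le> z" for n
    proof -
      define d where "d = (\<tau> - a) / real (Suc n)"
      define t where "t = (\<lambda>j::nat. a + real j * d)"
      have d: "0 < d" "real (Suc n) * d = \<tau> - a" using a by (simp_all add: d_def)
      have t0: "t 0 = a" and tn: "t (Suc n) = \<tau>" using d(2) by (simp_all add: t_def)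
      have tS: "t (Suc j) = t j + d" for j by (simp add: t_def algebra_simps)
      have t_ge: "a \<le> t j" for j using d by (simp add: t_def)
      have t_le: "t j \<le> \<tau>" if "j \<le> Suc n" for j
      proof -
        have "real j * d \<le> real (Suc n) * d" using that d(1) by (intro mult_right_mono) auto
        then show ?thesis using d(2) by (simp add: t_def)
      qed
      have tj: "0 < t j" "t j < t (Suc j)" "t (Suc j) \<le> \<tau>" if "j \<le> n" for j
        using t_ge[of j] a d t_le[of "Suc j"] that by (auto simp: tS)
      \<comment> \<open>Height 1 / B at the left time: there L, and with it B, is largest, so the
        rectangle stays below the integrand.\<close>
      define I where "I = (\<lambda>j. (L (t j) - L (t (Suc j))) / B (t j))"
      have I0: "0 \<le> I j" if "j \<le> n" for j
        using L_anti[of "t j" "t (Suc j)"] tj[OF that] B(2)[of "t j"] by (simp add: I_def)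
      have q_sum: "ennreal (\<Sum>i<j. I i) \<le> q_fun \<beta> (L (t j))" if "j \<le> Suc n" for j
        using that
      proof (induction j)
        case (Suc j)
        then have j: "j \<le> n" by simp
        have "ennreal (\<Sum>i<Suc j. I i) = ennreal (I j) + ennreal (\<Sum>i<j. I i)"
          unfolding sum.lessThan_Suc add.commute[of _ "I j"]
          using I0 j by (intro ennreal_plus sum_nonneg) auto
        also have "\<dots> \<le> ennreal (I j) + q_fun \<beta> (L (t j))"
          using Suc j by (intro add_left_mono) simp
        also have "\<dots> \<le> q_fun \<beta> (L (t (Suc j)))"
          unfolding I_def using L_anti[of "t j" "t (Suc j)"] tj[OF j] B[of "t j"]
          by (intro q_fun_step) auto
        finally show ?case .
      qed simp
      have I_lower: "2 * d * (1 + ln (B (t (Suc j))) - ln (B (t j))) / (1 + 2 * d * B a) \<le> I j"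
        if j: "j \<le> n" for j
      proof -
        let ?p = "B (t j)" and ?r = "B (t (Suc j))"
        have p: "0 < ?p" and r: "0 < ?r" and rB: "?r \<le> B a" and Ba: "0 < B a"
          using tj[OF j] B(2) B_anti[of a "t (Suc j)"] t_ge[of "Suc j"] a by auto
        have "ln (?r / ?p) \<le> ?r / ?p - 1" using p r by (intro ln_le_minus_one) simp
        then have "1 + ln ?r - ln ?p \<le> ?r / ?p" using p r by (simp add: ln_div)
        then have "2 * d * (1 + ln ?r - ln ?p) / (1 + 2 * d * B a)
            \<le> 2 * d * (?r / ?p) / (1 + 2 * d * B a)"
          using d Ba by (intro divide_right_mono mult_left_mono) auto
        also have "\<dots> = (2 * d * ?r / (1 + 2 * d * B a)) / ?p" by simp
        also have "\<dots> \<le> (2 * d * ?r / (1 + 2 * d * ?r)) / ?p"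
          using d p r rB Ba
          by (intro divide_right_mono divide_left_mono add_left_mono mult_left_mono mult_pos_pos) (auto simp: add_pos_pos)
        also have "\<dots> \<le> (L (t j) - L (t (Suc j))) / ?p"
          using drop[of "t j" "t (Suc j)"] tj[OF j] p by (intro divide_right_mono) (auto simp: tS)
        finally show ?thesis by (simp add: I_def)
      qed
      have tele: "(\<Sum>i<j. 1 + ln (B (t (Suc i))) - ln (B (t i))) = real j + ln (B (t j)) - ln (B a)" for j
        by (induction j) (simp_all add: t0)
      have "2 * d * (real (Suc n) + ln (B \<tau>) - ln (B a)) / (1 + 2 * d * B a)
          = (\<Sum>i<Suc n. 2 * d * (1 + ln (B (t (Suc i))) - ln (B (t i))) / (1 + 2 * d * B a))"
        unfolding sum_divide_distrib[symmetric] sum_distrib_left[symmetric] tele tn ..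
      also have "\<dots> \<le> (\<Sum>i<Suc n. I i)" by (intro sum_mono I_lower) auto
      also have "\<dots> \<le> z" using q_sum[of "Suc n"] z by (simp add: tn del: sum.lessThan_Suc)
      finally have "2 * d * (real (Suc n) + ln (B \<tau>) - ln (B a)) / (1 + 2 * d * B a) \<le> z" .
      moreover have "2 * d * (real (Suc n) + ln (B \<tau>) - ln (B a))
          = 2 * (\<tau> - a) * (1 + (ln (B \<tau>) - ln (B a)) / real (Suc n))"
        by (simp add: d_def field_simps)
      moreover have "2 * d * B a = 2 * (\<tau> - a) * B a / real (Suc n)" by (simp add: d_def)
      ultimately show ?thesis by simp
    qed
    \<comment> \<open>For fixed a the logarithmic correction is a constant divided by n + 1, so it
      disappears as the partition is refined.\<close>
    have "(\<lambda>n. 2 * (\<tau> - a) * (1 + (ln (B \<tau>) - ln (B a)) / real (Suc n))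
        / (1 + 2 * (\<tau> - a) * B a / real (Suc n))) \<longlonglongrightarrow> 2 * (\<tau> - a) * (1 + 0) / (1 + 0)"
      by (intro tendsto_intros real_tendsto_divide_at_top[OF tendsto_const]
          filterlim_compose[OF filterlim_real_sequentially] filterlim_Suc) auto
    then show ?thesis using approx by (intro LIMSEQ_le_const2[where a = z]) auto
  qed
  have "2 * \<tau> \<le> z"
  proof (rule field_le_epsilon)
    fix e :: real assume e: "0 < e"
    define a where "a = min (e / 2) (\<tau> / 2)"
    have "0 < a" "a < \<tau>" "2 * a \<le> e" using e \<tau> by (auto simp: a_def min_def)
    then show "2 * \<tau> \<le> z + e" using za[of a] by simp
  qed
  \<comment> \<open>q need not decrease strictly a priori; the contradiction comes from uniqueness
    of the solution of q s = 2 \<tau>.\<close>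
  then have "q_fun \<beta> (L \<tau>) = ennreal (2 * \<tau>)" using z by simp
  then have "L \<tau> = m (2 * \<tau>)" using inv \<tau> by (simp add: is_inverse_fun_def)
  then show False using less by (simp add: L_def)
qed

section \<open>Ultracontractivity\<close>

text \<open>The test set is {g > C + e}. Since g > e there and g is in L2, it has finite measure and
  is admissible; the test then forces its measure to vanish.\<close>

lemma AE_le_of_integral_indicator_le:
  assumes g: "g \<in> Lp M 2" and C: "0 \<le> C"
    and test: "\<And>E. E \<in> sets M \<Longrightarrow> emeasure M E < \<infinity> \<Longrightarrow> L2_inner M g (indicator E) \<le> C * measure M E"
  shows "AE x in M. g x \<le> C"
proof -
  have [measurable]: "g \<in> borel_measurable M" using g by (rule Lp_measurable)
  have "AE x in M. g x \<le> C + inverse (real (Suc n))" for n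
  proof -
    define e where "e = inverse (real (Suc n))"
    have e: "0 < e" by (simp add: e_def)
    define E where "E = {x \<in> space M. C + e < g x}"
    have E[measurable]: "E \<in> sets M" by (simp add: E_def)
    have intE: "integrable M (indicator E :: 'a \<Rightarrow> real)"
    proof (rule Bochner_Integration.integrable_bound)
      show "integrable M (\<lambda>x. (g x)\<^sup>2 / e\<^sup>2)" using g by (simp add: Lp2_iff)
      show "AE x in M. norm (indicator E x :: real) \<le> norm ((g x)\<^sup>2 / e\<^sup>2)"
      proof (rule AE_I2)
        fix x
        show "norm (indicator E x :: real) \<le> norm ((g x)\<^sup>2 / e\<^sup>2)"
        proof (cases "x \<in> E")
          case True
          then have "e \<le> g x" using C by (simp add: E_def)
          then have "e\<^sup>2 \<le> (g x)\<^sup>2" using e by (intro power_mono) auto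
          then show ?thesis using True e by simp
        qed simp
      qed
    qed simp
    then have fin: "emeasure M E < \<infinity>" using E by (simp add: integrable_indicator_iff)
    have E2: "indicator E \<in> Lp M 2"
      using intE by (simp add: Lp2_iff power2_eq_square indicator_inter_arith[symmetric])
    have "(C + e) * measure M E = (\<integral>x. (C + e) * indicator E x \<partial>M)" using E by simp
    also have "\<dots> \<le> L2_inner M g (indicator E)"
      unfolding L2_inner_def using L2_inner_integrable[OF g E2] intE
      by (intro integral_mono) (auto simp: E_def split: split_indicator)
    also have "\<dots> \<le> C * measure M E" by (rule test[OF E fin])
    finally have "measure M E \<le> 0" using e by (simp add: distrib_right mult_le_0_iff)
    then have "emeasure M E = 0" using fin by (simp add: emeasure_eq_ennreal_measure measure_le_0_iff less_top)
    then show ?thesis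
      by (intro AE_I[of M _ E]) (auto simp: E_def e_def not_le)
  qed
  then have "AE x in M. \<forall>n. g x \<le> C + inverse (real (Suc n))" by (simp add: AE_all_countable)
  then show ?thesis
  proof eventually_elim
    case (elim x)
    show ?case
    proof (rule field_le_epsilon)
      fix e :: real assume "0 < e"
      then obtain n where "inverse (real (Suc n)) < e" using reals_Archimedean by blast
      then show "g x \<le> C + e" using elim[rule_format, of n] by linarith
    qed
  qed
qed

lemma AE_abs_le_of_integral_indicator_le:
  assumes g: "g \<in> Lp M 2" and C: "0 \<le> C"
    and test: "\<And>E. E \<in> sets M \<Longrightarrow> emeasure M E < \<infinity> \<Longrightarrow> \<bar>L2_inner M g (indicator E)\<bar> \<le> C * measure M E"
  shows "AE x in M. \<bar>g x\<bar> \<le> C"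
proof -
  have "AE x in M. g x \<le> C"
    using test by (intro AE_le_of_integral_indicator_le[OF g C]) (meson abs_le_D1)
  moreover have "AE x in M. - g x \<le> C"
  proof (rule AE_le_of_integral_indicator_le[OF _ C])
    show "(\<lambda>x. - g x) \<in> Lp M 2" using Lp2_scale[OF g, of "-1"] by simp
    show "L2_inner M (\<lambda>x. - g x) (indicator E) \<le> C * measure M E"
      if "E \<in> sets M" "emeasure M E < \<infinity>" for E
      using test[OF that] by (simp add: L2_inner_def)
  qed
  ultimately show ?thesis by eventually_elim simp
qed

lemma indicator_Lp:
  assumes "E \<in> sets M" "emeasure M E < \<infinity>"
  shows "indicator E \<in> Lp M 1" "indicator E \<in> Lp M \<infinity>" "Lp_norm M 1 (indicator E) = measure M E"
proof -
  show "indicator E \<in> Lp M 1" using assms by (simp add: Lp1_iff integrable_indicator_iff)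
  show "indicator E \<in> Lp M \<infinity>"
    using assms by (auto simp: Lp_inf_iff intro!: exI[of _ 1] AE_I2 split: split_indicator)
  show "Lp_norm M 1 (indicator E) = measure M E" using assms by (simp add: Lp_norm_1)
qed

text \<open>Positivity is applied to \<bar>f\<bar> + f and \<bar>f\<bar> - f. This carries bounds
  for nonnegative functions, those covered by the logarithmic Sobolev inequality, over to signed
  ones.\<close>

lemma (in sym_submarkovian) abs_T_le:
  assumes "0 \<le> t" and f: "f \<in> Lp M 2"
  shows "AE x in M. \<bar>T t f x\<bar> \<le> T t (\<lambda>x. \<bar>f x\<bar>) x"
proof -
  let ?a = "\<lambda>x. \<bar>f x\<bar>"
  have a: "?a \<in> Lp M 2" using f by (rule Lp2_abs)
  have "AE x in M. 0 \<le> T t (\<lambda>x. 1 * ?a x + s * f x) x" if "s = 1 \<or> s = -1" for s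
    using assms that a by (intro T_pos Lp2_lincomb) auto
  from this[of 1] this[of "-1"]
  have "AE x in M. 0 \<le> T t (\<lambda>x. 1 * ?a x + 1 * f x) x" "AE x in M. 0 \<le> T t (\<lambda>x. 1 * ?a x + (- 1) * f x) x"
    by blast+
  then show ?thesis
    using T_lincomb[OF assms(1) a f, of 1 1] T_lincomb[OF assms(1) a f, of 1 "-1"]
    by eventually_elim linarith
qed

locale log_sobolev_semigroup = sym_submarkovian +
  fixes S :: "'a graph" and \<beta> m :: "real \<Rightarrow> real"
  assumes selfadj: "adjoint_graph M (generator M T) = generator M T"
    and sqrt: "is_sqrt_of M S (generator M T)"
    and log_sobolev: "\<And>t f. \<lbrakk>0 < t; f \<in> Domain S \<inter> Lp M 1 \<inter> Lp M \<infinity>;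
          AE x in M. 0 \<le> f x; \<not> (AE x in M. f x = 0)\<rbrakk> \<Longrightarrow>
        (\<integral>x. (f x)\<^sup>2 * ln (f x / Lp_norm M 2 f) \<partial>M)
          \<le> t * quad_form M S f + \<beta> t * (Lp_norm M 2 f)\<^sup>2"
    and inverse: "is_inverse_fun (q_fun \<beta>) m"
begin

lemma T_L1_L2_normalized:
  assumes f: "f \<in> Lp M 1" "f \<in> Lp M \<infinity>" "AE x in M. 0 \<le> f x" and norm: "Lp_norm M 1 f \<le> 1"
    and \<tau>: "0 < \<tau>"
  shows "L2_inner M (T \<tau> f) (T \<tau> f) \<le> exp (m (2 * \<tau>))"
proof -
  have f2: "f \<in> Lp M 2" using f by (intro Lp1_Lp_inf_Lp2)
  define \<phi> where "\<phi> = (\<lambda>t. L2_inner M (T t f) (T t f))"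
  have anti: "\<phi> b \<le> \<phi> a" if "0 \<le> a" "a \<le> b" for a b
    using corr_decreasing[of "2 * a" "2 * (b - a)" f] that f2
    by (simp add: \<phi>_def corr_eq_square[symmetric])
  show ?thesis
  \<comment> \<open>The logarithm needs \<phi> > 0 on all of [0, \<tau>]; by monotonicity only the
    end point can cause failure, and there the claim is trivial.\<close>
  proof (cases "\<phi> \<tau> = 0")
    case True
    then show ?thesis by (simp add: \<phi>_def)
  next
    case False
    then have "0 < \<phi> \<tau>" by (simp add: \<phi>_def less_le)
    then have pos: "0 < \<phi> t" if "0 \<le> t" "t \<le> \<tau>" for t
      using anti[OF that] by linarith
    have "ln (\<phi> \<tau>) \<le> m (2 * \<tau>)"
    proof (rule q_fun_decay[OF inverse \<tau> pos anti])
      fix a b assume ab: "0 \<le> a" "a < b" "b \<le> \<tau>"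
      let ?u = "T b f"
      \<comment> \<open>The inequality is applied at the right end b, so even for a = 0 it concerns
        a smoothed function; f itself may lie outside the form domain.\<close>
      have b: "0 < b" using ab by simp
      obtain h where h: "(?u, h) \<in> generator M T"
        using T_in_generator_domain[OF selfadj b f2] by blast
      let ?Q = "L2_inner M h ?u"
      have u: "?u \<in> Lp M 1" "?u \<in> Lp M \<infinity>" "AE x in M. 0 \<le> ?u x"
        using b f f2 T_pos[OF less_imp_le[OF b] f2 f(3)] by (auto intro: T_Lp(1))
      have norm_u: "Lp_norm M 1 ?u \<le> 1"
        using T_Lp(2)[of b f 1] b f f2 norm by simp
      have N: "0 < L2_inner M ?u ?u" using pos[of b] ab by (simp add: \<phi>_def)
      have "\<not> (AE x in M. ?u x = 0)"
      proof
        assume "AE x in M. ?u x = 0"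
        then have "L2_inner M ?u ?u = (\<integral>x. 0 \<partial>M)"
          unfolding L2_inner_def using Lp_measurable[OF u(1)]
          by (intro integral_cong_AE) (auto elim: eventually_mono)
        then show False using N by simp
      qed
      then have "(\<integral>x. (?u x)\<^sup>2 * ln (?u x / Lp_norm M 2 ?u) \<partial>M)
          \<le> t * ?Q + \<beta> t * (Lp_norm M 2 ?u)\<^sup>2" if "0 < t" for t
        using log_sobolev[OF that, of ?u] quad_form_eq[OF sqrt h] u by simp
      from Nash_inequality[OF u N norm_u this]
      have "B_fun \<beta> (ln (\<phi> b)) \<le> ereal (?Q / \<phi> b)" by (simp add: \<phi>_def)
      also have "?Q / \<phi> b \<le> (\<phi> a - \<phi> b) / (2 * (b - a)) / \<phi> b"
        using dissipation[OF ab(1,2) f2 h] ab(2) pos[of b] ab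
        by (intro divide_right_mono) (auto simp: \<phi>_def pos_le_divide_eq mult.commute)
      finally show "B_fun \<beta> (ln (\<phi> b)) \<le> ereal ((\<phi> a - \<phi> b) / (2 * (b - a)) / \<phi> b)" by simp
    qed auto
    then have "\<phi> \<tau> \<le> exp (m (2 * \<tau>))" using \<open>0 < \<phi> \<tau>\<close> by (metis exp_le_cancel_iff exp_ln)
    then show ?thesis by (simp add: \<phi>_def)
  qed
qed

text \<open>Domination by T \<tau> \<bar>f\<bar> and scaling by the L1 norm reduce to the normalised
  case. A vanishing norm cannot be scaled, but then f = 0 almost everywhere.\<close>

lemma T_L1_L2:
  assumes f: "f \<in> Lp M 1" "f \<in> Lp M \<infinity>" and \<tau>: "0 < \<tau>"
  shows "Lp_norm M 2 (T \<tau> f) \<le> exp (m (2 * \<tau>) / 2) * Lp_norm M 1 f"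
proof -
  have f2: "f \<in> Lp M 2" using f by (rule Lp1_Lp_inf_Lp2)
  have [measurable]: "f \<in> borel_measurable M" using f2 by (rule Lp_measurable)
  define c where "c = Lp_norm M 1 f"
  have c0: "0 \<le> c" by (simp add: c_def Lp_norm_1)
  have Tf: "T \<tau> f \<in> Lp M 2" using f2 \<tau> by (simp add: T_Lp2)
  have "L2_inner M (T \<tau> f) (T \<tau> f) \<le> c\<^sup>2 * exp (m (2 * \<tau>))"
  proof (cases "c = 0")
    case True
    then have "AE x in M. \<bar>f x\<bar> = 0"
      using f by (subst (asm) c_def, subst (asm) Lp_norm_1)
        (subst (asm) integral_nonneg_eq_0_iff_AE, auto simp: Lp1_iff)
    then have "L2_inner M f f = (\<integral>x. 0 \<partial>M)"
      unfolding L2_inner_def by (intro integral_cong_AE) (auto elim: eventually_mono)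
    then show ?thesis using True T_inner_contraction[of \<tau> f] \<tau> f2 by simp
  next
    case False
    then have c: "0 < c" using c0 by simp
    let ?a = "\<lambda>x. \<bar>f x\<bar>"
    define g where "g = (\<lambda>x. 1 / c * ?a x)"
    have a2: "?a \<in> Lp M 2" using f2 by (rule Lp2_abs)
    have Tg: "T \<tau> g \<in> Lp M 2" unfolding g_def using \<tau> a2 by (intro T_Lp2 Lp2_scale) auto
    have "AE x in M. \<bar>T \<tau> f x\<bar> \<le> c * T \<tau> g x"
      using abs_T_le[OF less_imp_le[OF \<tau>] f2] T_scale[OF less_imp_le[OF \<tau>] a2, of "1 / c"]
      by eventually_elim (use c in \<open>simp add: g_def\<close>)
    then have "AE x in M. T \<tau> f x * T \<tau> f x \<le> c\<^sup>2 * (T \<tau> g x * T \<tau> g x)"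
    proof eventually_elim
      case (elim x)
      then have "\<bar>T \<tau> f x\<bar> * \<bar>T \<tau> f x\<bar> \<le> (c * T \<tau> g x) * (c * T \<tau> g x)"
        by (intro mult_mono) auto
      then show ?case by (simp add: power2_eq_square algebra_simps)
    qed
    then have "L2_inner M (T \<tau> f) (T \<tau> f) \<le> (\<integral>x. c\<^sup>2 * (T \<tau> g x * T \<tau> g x) \<partial>M)"
      unfolding L2_inner_def using L2_inner_integrable[OF Tf Tf] L2_inner_integrable[OF Tg Tg]
      by (intro integral_mono_AE) auto
    also have "\<dots> = c\<^sup>2 * L2_inner M (T \<tau> g) (T \<tau> g)" by (simp add: L2_inner_def)
    also have "\<dots> \<le> c\<^sup>2 * exp (m (2 * \<tau>))"
    proof (intro mult_left_mono T_L1_L2_normalized)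
      show "g \<in> Lp M 1" using f by (simp add: g_def Lp1_iff)
      obtain C where "AE x in M. \<bar>f x\<bar> \<le> C" using f by (auto simp: Lp_inf_iff)
      then have "AE x in M. \<bar>g x\<bar> \<le> C / c"
        by eventually_elim (use c in \<open>simp add: g_def divide_right_mono\<close>)
      then show "g \<in> Lp M \<infinity>" by (auto simp: Lp_inf_iff g_def)
      show "AE x in M. 0 \<le> g x" using c by (simp add: g_def)
      show "Lp_norm M 1 g \<le> 1" using c by (simp add: g_def Lp_norm_1 abs_mult) (simp add: c_def Lp_norm_1)
    qed (use \<tau> in auto)
    finally show ?thesis .
  qed
  also have "\<dots> = (exp (m (2 * \<tau>) / 2) * c)\<^sup>2"
    by (simp add: power_mult_distrib exp_double[symmetric])
  finally have "L2_inner M (T \<tau> f) (T \<tau> f) \<le> (exp (m (2 * \<tau>) / 2) * c)\<^sup>2" .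
  then show ?thesis
    using c0 by (simp add: Lp_norm_2 real_le_lsqrt c_def)
qed

text \<open>Tested against an indicator, T \<tau> splits into T (\<tau> / 2) on either side, and
  both factors are controlled by the L1 to L2 bound at time \<tau> / 2.\<close>

lemma T_bounded_of_L1_inf:
  assumes f: "f \<in> Lp M 1" "f \<in> Lp M \<infinity>" and \<tau>: "0 < \<tau>"
  shows "AE x in M. \<bar>T \<tau> f x\<bar> \<le> exp (m \<tau>) * Lp_norm M 1 f"
proof (rule AE_abs_le_of_integral_indicator_le)
  have f2: "f \<in> Lp M 2" using f by (rule Lp1_Lp_inf_Lp2)
  then show "T \<tau> f \<in> Lp M 2" using \<tau> by (simp add: T_Lp2)
  show "0 \<le> exp (m \<tau>) * Lp_norm M 1 f" by (simp add: Lp_norm_1)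
  fix E assume E: "E \<in> sets M" "emeasure M E < \<infinity>"
  let ?h = "indicator E :: 'a \<Rightarrow> real"
  have h2: "?h \<in> Lp M 2" using indicator_Lp[OF E] by (intro Lp1_Lp_inf_Lp2)
  have \<tau>2: "0 < \<tau> / 2" "2 * (\<tau> / 2) = \<tau>" using \<tau> by auto
  have "L2_inner M (T \<tau> f) ?h = L2_inner M (T (\<tau> / 2) f) (T (\<tau> / 2) ?h)"
    using inner_T_T[of "\<tau> / 2" "\<tau> / 2" f ?h] \<tau> f2 h2 by simp
  also have "\<bar>\<dots>\<bar> \<le> Lp_norm M 2 (T (\<tau> / 2) f) * Lp_norm M 2 (T (\<tau> / 2) ?h)"
    using \<tau> f2 h2 by (intro L2_inner_Cauchy_Schwarz T_Lp2) auto
  also have "\<dots> \<le> (exp (m \<tau> / 2) * Lp_norm M 1 f) * (exp (m \<tau> / 2) * measure M E)"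
    using T_L1_L2[OF f \<tau>2(1)] T_L1_L2[OF indicator_Lp(1,2)[OF E] \<tau>2(1)]
    unfolding \<tau>2(2) indicator_Lp(3)[OF E]
    by (intro mult_mono) (auto simp: Lp_norm_2 Lp_norm_1)
  also have "\<dots> = (exp (m \<tau> / 2) * exp (m \<tau> / 2)) * Lp_norm M 1 f * measure M E" by simp
  also have "exp (m \<tau> / 2) * exp (m \<tau> / 2) = exp (m \<tau>)" by (simp add: exp_add[symmetric])
  finally show "\<bar>L2_inner M (T \<tau> f) ?h\<bar> \<le> exp (m \<tau>) * Lp_norm M 1 f * measure M E" .
qed

text \<open>Approximants in \<open>L1_extension\<close> need not be bounded. Symmetry moves T \<tau>
  onto the indicator, which is bounded, so the previous estimate applies to it.\<close>

lemma T_bounded_of_L1_L2: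
  assumes f1: "f \<in> Lp M 1" and f2: "f \<in> Lp M 2" and \<tau>: "0 < \<tau>"
  shows "AE x in M. \<bar>T \<tau> f x\<bar> \<le> exp (m \<tau>) * Lp_norm M 1 f"
proof (rule AE_abs_le_of_integral_indicator_le)
  show "T \<tau> f \<in> Lp M 2" using \<tau> f2 by (simp add: T_Lp2)
  show "0 \<le> exp (m \<tau>) * Lp_norm M 1 f" by (simp add: Lp_norm_1)
  fix E assume E: "E \<in> sets M" "emeasure M E < \<infinity>"
  let ?h = "indicator E :: 'a \<Rightarrow> real"
  have h2: "?h \<in> Lp M 2" using indicator_Lp[OF E] by (intro Lp1_Lp_inf_Lp2)
  have Th2: "T \<tau> ?h \<in> Lp M 2" using \<tau> h2 by (simp add: T_Lp2)
  have Th: "AE x in M. \<bar>T \<tau> ?h x\<bar> \<le> exp (m \<tau>) * measure M E"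
    using T_bounded_of_L1_inf[OF indicator_Lp(1,2)[OF E] \<tau>] indicator_Lp(3)[OF E] by simp
  have "L2_inner M (T \<tau> f) ?h = L2_inner M f (T \<tau> ?h)"
    using \<tau> f2 h2 by (intro T_symmetric) auto
  also have "\<bar>\<dots>\<bar> \<le> (\<integral>x. \<bar>f x * T \<tau> ?h x\<bar> \<partial>M)"
    unfolding L2_inner_def by (rule integral_abs_bound)
  also have "\<dots> \<le> (\<integral>x. (exp (m \<tau>) * measure M E) * \<bar>f x\<bar> \<partial>M)"
  proof (rule integral_mono_AE)
    show "AE x in M. \<bar>f x * T \<tau> ?h x\<bar> \<le> (exp (m \<tau>) * measure M E) * \<bar>f x\<bar>"
      using Th by eventually_elim (subst mult.commute, simp add: abs_mult mult_left_mono)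
  qed (use L2_inner_integrable[OF f2 Th2] f1 in \<open>auto simp: Lp1_iff\<close>)
  finally show "\<bar>L2_inner M (T \<tau> f) ?h\<bar> \<le> exp (m \<tau>) * Lp_norm M 1 f * measure M E"
    by (simp add: Lp_norm_1 mult_ac)
qed

end

section \<open>Extension of the bound to all of L1\<close>

lemma L1_truncation:
  assumes f: "f \<in> Lp M 1" and "0 < e"
  obtains g where "g \<in> Lp M 1" "g \<in> Lp M 2" "Lp_norm M 1 (\<lambda>x. g x - f x) < e"
proof -
  define g where "g = (\<lambda>(n::nat) x. f x * indicator {x \<in> space M. \<bar>f x\<bar> \<le> real n} x)"
  have int: "integrable M f" and [measurable]: "f \<in> borel_measurable M"
    using f by (auto simp: Lp1_iff)
  have le: "\<bar>g n x\<bar> \<le> \<bar>f x\<bar>" for n x by (simp add: g_def split: split_indicator)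
  have [measurable]: "g n \<in> borel_measurable M" for n by (simp add: g_def)
  have g1: "integrable M (g n)" for n
    by (rule Bochner_Integration.integrable_bound[OF int]) (use le in auto)
  have "g n \<in> Lp M \<infinity>" for n
    by (auto simp: Lp_inf_iff g_def intro!: exI[of _ "real n"] AE_I2 split: split_indicator)
  then have g2: "g n \<in> Lp M 2" for n using g1 by (intro Lp1_Lp_inf_Lp2) (auto simp: Lp1_iff)
  have "(\<lambda>n. \<integral>x. \<bar>g n x - f x\<bar> \<partial>M) \<longlonglongrightarrow> (\<integral>x. 0 \<partial>M)"
  proof (rule integral_dominated_convergence)
    show "integrable M (\<lambda>x. \<bar>f x\<bar>)" using int by simp
    show "AE x in M. (\<lambda>n. \<bar>g n x - f x\<bar>) \<longlonglongrightarrow> 0"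
    proof (rule AE_I2)
      fix x assume x: "x \<in> space M"
      obtain n0 where n0: "\<bar>f x\<bar> \<le> real n0" using real_arch_simple by blast
      show "(\<lambda>n. \<bar>g n x - f x\<bar>) \<longlonglongrightarrow> 0"
        by (rule tendsto_eventually, rule eventually_sequentiallyI[of n0])
          (use n0 x in \<open>auto simp: g_def\<close>)
    qed
    show "AE x in M. norm \<bar>g n x - f x\<bar> \<le> \<bar>f x\<bar>" for n
      by (simp add: g_def split: split_indicator)
  qed auto
  then have "\<forall>\<^sub>F n in sequentially. (\<integral>x. \<bar>g n x - f x\<bar> \<partial>M) < e"
    using assms(2) by (intro order_tendstoD) auto
  then obtain n where "(\<integral>x. \<bar>g n x - f x\<bar> \<partial>M) < e" by (auto simp: eventually_sequentially)
  then show thesis using g1 g2 that[of "g n"] by (simp add: Lp1_iff Lp_norm_1)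
qed

lemma L1_norm_triangle:
  assumes "integrable M f" "integrable M g" "integrable M h"
  shows "Lp_norm M 1 (\<lambda>x. f x - g x) \<le> Lp_norm M 1 (\<lambda>x. f x - h x) + Lp_norm M 1 (\<lambda>x. g x - h x)"
proof -
  have "(\<integral>x. \<bar>f x - g x\<bar> \<partial>M) \<le> (\<integral>x. \<bar>f x - h x\<bar> + \<bar>g x - h x\<bar> \<partial>M)"
    using assms by (intro integral_mono) auto
  also have "\<dots> = (\<integral>x. \<bar>f x - h x\<bar> \<partial>M) + (\<integral>x. \<bar>g x - h x\<bar> \<partial>M)"
    using assms by (intro Bochner_Integration.integral_add) auto
  finally show ?thesis by (simp add: Lp_norm_1)
qed

text \<open>The defining property is satisfiable, so \<open>SOME\<close> in \<open>L1_extension\<close> is not vacuous.\<close>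

lemma (in sym_submarkovian) L1_extension_approx:
  assumes t: "0 \<le> t" and f: "f \<in> Lp M 1"
  shows "L1_extension M (T t) f \<in> Lp M 1 \<and>
    (\<exists>u. (\<forall>n::nat. u n \<in> Lp M 1 \<inter> Lp M 2) \<and>
      (\<lambda>n. Lp_norm M 1 (\<lambda>x. u n x - f x)) \<longlonglongrightarrow> 0 \<and>
      (\<lambda>n. Lp_norm M 1 (\<lambda>x. T t (u n) x - L1_extension M (T t) f x)) \<longlonglongrightarrow> 0)"
proof -
  \<comment> \<open>The rate 2^-n survives the L1 contraction T t, so the images converge fast
    enough for \<open>L1_geometric_limit\<close>.\<close>
  have "\<exists>g. g \<in> Lp M 1 \<inter> Lp M 2 \<and> Lp_norm M 1 (\<lambda>x. g x - f x) < (1/2) ^ n" for n :: nat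
  proof -
    have "(0::real) < (1/2) ^ n" by simp
    from L1_truncation[OF f this] show ?thesis by blast
  qed
  then obtain u where u: "\<And>n. u n \<in> Lp M 1 \<inter> Lp M 2"
    and close: "\<And>n::nat. Lp_norm M 1 (\<lambda>x. u n x - f x) < (1/2) ^ n"
    by metis
  have half: "(\<lambda>n. (1/2::real) ^ n) \<longlonglongrightarrow> 0" by (rule LIMSEQ_realpow_zero) auto
  have lim: "(\<lambda>n. Lp_norm M 1 (\<lambda>x. u n x - f x)) \<longlonglongrightarrow> 0"
    by (rule tendsto_sandwich[OF _ _ tendsto_const half]) (use close in \<open>auto simp: less_imp_le Lp_norm_1\<close>)
  have Tu: "T t (u n) \<in> Lp M 1" for n using T_Lp(1)[of t "u n" 1] t u by auto
  obtain g where g: "integrable M g" "(\<lambda>n. \<integral>x. \<bar>T t (u n) x - g x\<bar> \<partial>M) \<longlonglongrightarrow> 0"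
  proof (rule L1_geometric_limit)
    show "integrable M (T t (u n))" for n using Tu[of n] by (simp add: Lp1_iff)
    fix n
    let ?d = "\<lambda>x. u (Suc n) x - u n x"
    have d: "?d \<in> Lp M 1" "?d \<in> Lp M 2"
      using u[of n] u[of "Suc n"] by (auto simp: Lp1_iff intro: Lp2_diff)
    have "(\<integral>x. \<bar>T t (u (Suc n)) x - T t (u n) x\<bar> \<partial>M) = Lp_norm M 1 (T t ?d)"
      unfolding Lp_norm_1
      using T_diff[OF t, of "u (Suc n)" "u n"] u t d Lp_measurable[OF Tu] T_measurable[OF t d(2)]
      by (intro integral_cong_AE) (auto elim: eventually_mono)
    also have "\<dots> \<le> Lp_norm M 1 ?d" using T_Lp(2)[of t ?d 1] t d by auto
    also have "\<dots> \<le> Lp_norm M 1 (\<lambda>x. u (Suc n) x - f x) + Lp_norm M 1 (\<lambda>x. u n x - f x)"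
      using u[of n] u[of "Suc n"] f by (intro L1_norm_triangle) (auto simp: Lp1_iff)
    also have "\<dots> \<le> 2 * (1/2) ^ n" using close[of n] close[of "Suc n"] zero_le_power[of "1/2::real" n]
      by (simp del: zero_le_power)
    finally show "(\<integral>x. \<bar>T t (u (Suc n)) x - T t (u n) x\<bar> \<partial>M) \<le> 2 * (1/2) ^ n" .
  qed
  then have "\<exists>g. g \<in> Lp M 1 \<and> (\<exists>u. (\<forall>n::nat. u n \<in> Lp M 1 \<inter> Lp M 2) \<and>
      (\<lambda>n. Lp_norm M 1 (\<lambda>x. u n x - f x)) \<longlonglongrightarrow> 0 \<and>
      (\<lambda>n. Lp_norm M 1 (\<lambda>x. T t (u n) x - g x)) \<longlonglongrightarrow> 0)"
    using u lim by (intro exI[of _ g] conjI exI[of _ u]) (auto simp: Lp1_iff Lp_norm_1)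
  from someI_ex[OF this] show ?thesis unfolding L1_extension_def .
qed

text \<open>L1 convergence is pointwise only along a subsequence, which suffices. The bounds vary
  with n because they contain the norms of the approximants.\<close>

lemma L1_limit_AE_bound:
  assumes v: "\<And>n. integrable M (v n)" and g: "integrable M g"
    and lim: "(\<lambda>n. Lp_norm M 1 (\<lambda>x. v n x - g x)) \<longlonglongrightarrow> 0"
    and bound: "\<And>n. AE x in M. \<bar>v n x\<bar> \<le> c n" and c: "c \<longlonglongrightarrow> C"
  shows "AE x in M. \<bar>g x\<bar> \<le> C"
proof -
  obtain r where r: "strict_mono (r :: nat \<Rightarrow> nat)"
    and conv: "AE x in M. (\<lambda>n. v (r n) x - g x) \<longlonglongrightarrow> 0"
    using tendsto_L1_AE_subseq[of M "\<lambda>n x. v n x - g x"] v g lim by (auto simp: Lp_norm_1)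
  have "AE x in M. \<forall>n. \<bar>v n x\<bar> \<le> c n" using bound by (simp add: AE_all_countable)
  with conv show ?thesis
  proof eventually_elim
    case (elim x)
    have "(\<lambda>n. v (r n) x) \<longlonglongrightarrow> g x" using elim(1) by (rule LIM_zero_cancel)
    moreover have "(\<lambda>n. c (r n)) \<longlonglongrightarrow> C" using LIMSEQ_subseq_LIMSEQ[OF c r] by (simp add: o_def)
    ultimately show ?case using elim(2) by (intro LIMSEQ_le[OF tendsto_rabs]) auto
  qed
qed

lemma Lp_inf_norm_le:
  assumes "f \<in> borel_measurable M" "AE x in M. \<bar>f x\<bar> \<le> C" "0 \<le> C"
  shows "f \<in> Lp M \<infinity>" "Lp_norm M \<infinity> f \<le> C"
proof -
  show "f \<in> Lp M \<infinity>" using assms by (auto simp: Lp_inf_iff)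
  have "esssup M (\<lambda>x. ereal \<bar>f x\<bar>) \<le> ereal C" using assms by (intro esssup_I) auto
  \<comment> \<open>On a null space the essential supremum is - \<infinity>, which
    \<open>real_of_ereal\<close> sends to 0; hence the requirement 0 \<le> C.\<close>
  then show "Lp_norm M \<infinity> f \<le> C"
    using assms(3) by (cases "esssup M (\<lambda>x. ereal \<bar>f x\<bar>)") (auto simp: Lp_norm_def)
qed

text \<open>\<open>SOME\<close> reveals neither the limit nor its approximants, so the argument
  takes whatever sequence it comes with; only convergence of the L1 norms is used to keep the
  constant sharp.\<close>

lemma (in log_sobolev_semigroup) T_bounded_of_L1:
  assumes t: "0 < t" and f: "f \<in> Lp M 1"
  shows "AE x in M. \<bar>L1_extension M (T t) f x\<bar> \<le> exp (m t) * Lp_norm M 1 f"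
proof -
  let ?g = "L1_extension M (T t) f"
  obtain u where g: "?g \<in> Lp M 1" and u: "\<And>n::nat. u n \<in> Lp M 1 \<inter> Lp M 2"
    and lim: "(\<lambda>n. Lp_norm M 1 (\<lambda>x. u n x - f x)) \<longlonglongrightarrow> 0"
    and Tlim: "(\<lambda>n. Lp_norm M 1 (\<lambda>x. T t (u n) x - ?g x)) \<longlonglongrightarrow> 0"
    using L1_extension_approx[OF less_imp_le[OF t] f] by blast
  have norm_conv: "(\<lambda>n. Lp_norm M 1 (u n)) \<longlonglongrightarrow> Lp_norm M 1 f"
  proof (rule LIM_zero_cancel, rule tendsto_rabs_zero_cancel,
      rule tendsto_sandwich[OF _ _ tendsto_const lim])
    have "\<bar>Lp_norm M 1 (u n) - Lp_norm M 1 f\<bar> \<le> Lp_norm M 1 (\<lambda>x. u n x - f x)" for n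
      using L1_norm_triangle[of M "u n" "\<lambda>_. 0" f] L1_norm_triangle[of M f "\<lambda>_. 0" "u n"] u[of n] f
      by (simp add: Lp1_iff Lp_norm_1 abs_minus_commute)
    then show "\<forall>\<^sub>F n in sequentially. \<bar>Lp_norm M 1 (u n) - Lp_norm M 1 f\<bar> \<le> Lp_norm M 1 (\<lambda>x. u n x - f x)"
      by simp
  qed simp
  show ?thesis
  proof (rule L1_limit_AE_bound[OF _ _ Tlim])
    show "integrable M (T t (u n))" for n
      using T_Lp(1)[of t "u n" 1] t u[of n] by (simp add: Lp1_iff)
    show "integrable M ?g" using g by (simp add: Lp1_iff)
    show "AE x in M. \<bar>T t (u n) x\<bar> \<le> exp (m t) * Lp_norm M 1 (u n)" for n
      using T_bounded_of_L1_L2[of "u n" t] u[of n] t by simp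
    show "(\<lambda>n. exp (m t) * Lp_norm M 1 (u n)) \<longlonglongrightarrow> exp (m t) * Lp_norm M 1 f"
      by (intro tendsto_mult_left norm_conv)
  qed
qed

theorem theorem3p5:
  fixes \<mu> :: "'a measure"
    and T :: "real \<Rightarrow> ('a \<Rightarrow> real) \<Rightarrow> 'a \<Rightarrow> real"
    and A sqrtA :: "(('a \<Rightarrow> real) \<times> ('a \<Rightarrow> real)) set"
    and \<beta> M :: "real \<Rightarrow> real"
  assumes "sigma_finite_measure \<mu>"
    and "symmetric_submarkovian_semigroup \<mu> T"
    and "nonneg_selfadjoint \<mu> A" and "A = generator \<mu> T"
    and "is_sqrt_of \<mu> sqrtA A"
    and log_sobolev:
      "\<And>t f. \<lbrakk>0 < t; f \<in> Domain sqrtA \<inter> Lp \<mu> 1 \<inter> Lp \<mu> \<infinity>;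
          AE x in \<mu>. 0 \<le> f x; \<not> (AE x in \<mu>. f x = 0)\<rbrakk> \<Longrightarrow>
        (\<integral>x. (f x)\<^sup>2 * ln (f x / Lp_norm \<mu> 2 f) \<partial>\<mu>)
          \<le> t * quad_form \<mu> sqrtA f + \<beta> t * (Lp_norm \<mu> 2 f)\<^sup>2"
    and "\<exists>s. q_fun \<beta> s < \<infinity>"
    and "is_inverse_fun (q_fun \<beta>) M"
  shows "\<forall>t > 0. \<forall>f \<in> Lp \<mu> 1.
    L1_extension \<mu> (T t) f \<in> Lp \<mu> \<infinity> \<and>
    Lp_norm \<mu> \<infinity> (L1_extension \<mu> (T t) f) \<le> exp (M t) * Lp_norm \<mu> 1 f"
proof -
  interpret log_sobolev_semigroup \<mu> T sqrtA \<beta> M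
    by unfold_locales (use assms in \<open>auto simp: nonneg_selfadjoint_def\<close>)
  show ?thesis
  proof (intro allI impI ballI)
    fix t :: real and f assume t: "0 < t" and f: "f \<in> Lp \<mu> 1"
    have "L1_extension \<mu> (T t) f \<in> borel_measurable \<mu>"
      using L1_extension_approx[of t f] t f by (intro Lp_measurable) auto
    from Lp_inf_norm_le[OF this T_bounded_of_L1[OF t f]]
    show "L1_extension \<mu> (T t) f \<in> Lp \<mu> \<infinity> \<and>
        Lp_norm \<mu> \<infinity> (L1_extension \<mu> (T t) f) \<le> exp (M t) * Lp_norm \<mu> 1 f"
      by (simp add: Lp_norm_1)
  qed
qed

end
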